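(* Let $n>1$ and let $K$ be a centrally symmetric star body in $\mathbb{R}^n$ with norming functional $\|x\|=\min\{a>0: x\in aK\}$. Then for every $\xi\in\Omega$, $$\mathrm{Vol}_{n-1}(K\cap\xi^{\perp})=\frac{1}{\pi(n-1)}\,\big(\|x\|^{-n+1}\big)^{\wedge}(\xi).$$
   Context: $\Omega$ is the Euclidean unit sphere in $\mathbb{R}^n$ and $\xi^\perp=\{x\in\mathbb{R}^n:(x,\xi)=0\}$. A centrally symmetric star body is a compact, origin-symmetric set, star-shaped with respect to the origin, containing the origin in its interior, and such that its norming functional $\|\cdot\|$ is a continuous, non-negative, even homogeneous function of degree $1$ on $\mathbb{R}^n$. The Fourier transform is taken in the sense of tempered distributions, with $\hat\phi(\xi)=\int_{\mathbb{R}^n}\phi(x)e^{-i(x,\xi)}\,dx$ for test functions and $(\hat f,\phi)=(f,\hat\phi)$ for distributions. The assertion includes that the Fourier transform of the locally integrable function $x\mapsto\|x\|^{-n+1}$ is a continuous function on $\mathbb{R}^n\setminus\{0\}$ (homogeneous of degree $-1$), which is evaluated at $\xi$. *)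

theory Defs
  imports "HOL-Analysis.Analysis"
begin

section \<open>Star bodies\<close>

text \<open>For compact \<open>K\<close> and \<open>x \<noteq> 0\<close> this infimum is a minimum whenever the set is nonempty;
  at \<open>x = 0\<close> no minimum over positive \<open>a\<close> exists, and the infimum gives the value \<open>0\<close> required
  by continuity and homogeneity.\<close>

definition norming :: "'a::real_vector set \<Rightarrow> 'a \<Rightarrow> real" where
  "norming K x = Inf {a. a > 0 \<and> x \<in> (\<lambda>y. a *\<^sub>R y) ` K}"

definition centrally_symmetric_star_body :: "'a::euclidean_space set \<Rightarrow> bool" where
  "centrally_symmetric_star_body K \<longleftrightarrow>
     compact K \<and>
     (\<forall>x\<in>K. - x \<in> K) \<and>
     (\<forall>x\<in>K. closed_segment 0 x \<subseteq> K) \<and>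
     0 \<in> interior K \<and>
     continuous_on UNIV (norming K) \<and>
     (\<forall>x. 0 \<le> norming K x) \<and>
     (\<forall>c x. norming K (c *\<^sub>R x) = \<bar>c\<bar> * norming K x)"

section \<open>Volume on linear subspaces\<close>

definition orthonormal_basis_of :: "'a::euclidean_space set \<Rightarrow> 'a set \<Rightarrow> bool" where
  "orthonormal_basis_of S B \<longleftrightarrow>
     pairwise orthogonal B \<and> (\<forall>b\<in>B. norm b = 1) \<and> span B = S"

text \<open>Lebesgue measure of dimension \<open>dim S\<close> on a linear subspace \<open>S\<close>, transported from coordinates
  with respect to an orthonormal basis of \<open>S\<close>, just as \<^const>\<open>lborel\<close> is built from \<^const>\<open>Basis\<close>.
  By rotation invariance of Lebesgue measure the choice of basis does not matter.\<close>

definition subspace_lborel :: "'a::euclidean_space set \<Rightarrow> 'a measure" where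
  "subspace_lborel S =
     (let B = (SOME B. orthonormal_basis_of S B)
      in distr (\<Pi>\<^sub>M b\<in>B. (lborel :: real measure)) borel (\<lambda>c. \<Sum>b\<in>B. c b *\<^sub>R b))"

definition perp :: "'a::euclidean_space \<Rightarrow> 'a set" where
  "perp \<xi> = {x. x \<bullet> \<xi> = 0}"

section \<open>Schwartz functions and tempered distributions\<close>

text \<open>Iterated partial derivatives. Multi-indices are encoded as lists of basis vectors; the
  derivative along the head of the list is taken last.\<close>

primrec iter_deriv :: "'a::euclidean_space list \<Rightarrow> ('a \<Rightarrow> complex) \<Rightarrow> 'a \<Rightarrow> complex" where
  "iter_deriv [] \<phi> = \<phi>"
| "iter_deriv (v # vs) \<phi> = (\<lambda>x. frechet_derivative (iter_deriv vs \<phi>) (at x) v)"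

definition smooth :: "('a::euclidean_space \<Rightarrow> complex) \<Rightarrow> bool" where
  "smooth \<phi> \<longleftrightarrow> (\<forall>vs. set vs \<subseteq> Basis \<longrightarrow> (\<forall>x. iter_deriv vs \<phi> differentiable (at x)))"

definition schwartz :: "('a::euclidean_space \<Rightarrow> complex) \<Rightarrow> bool" where
  "schwartz \<phi> \<longleftrightarrow> smooth \<phi> \<and>
     (\<forall>m vs. set vs \<subseteq> Basis \<longrightarrow> bounded (range (\<lambda>x. norm x ^ m *\<^sub>R iter_deriv vs \<phi> x)))"

definition schwartz_seminorm ::
    "nat \<Rightarrow> 'a::euclidean_space list \<Rightarrow> ('a \<Rightarrow> complex) \<Rightarrow> real" where
  "schwartz_seminorm m vs \<phi> = (SUP x. norm x ^ m * norm (iter_deriv vs \<phi> x))"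

text \<open>A distribution is a functional on all functions, of which only the values on Schwartz
  functions matter. The last conjunct is continuity for the topology generated by the
  seminorms above.\<close>

definition tempered_distribution :: "(('a::euclidean_space \<Rightarrow> complex) \<Rightarrow> complex) \<Rightarrow> bool" where
  "tempered_distribution T \<longleftrightarrow>
     (\<forall>\<phi> \<psi>. schwartz \<phi> \<longrightarrow> schwartz \<psi> \<longrightarrow> T (\<lambda>x. \<phi> x + \<psi> x) = T \<phi> + T \<psi>) \<and>
     (\<forall>c \<phi>. schwartz \<phi> \<longrightarrow> T (\<lambda>x. c * \<phi> x) = c * T \<phi>) \<and>
     (\<exists>C N. \<forall>\<phi>. schwartz \<phi> \<longrightarrow>
        norm (T \<phi>) \<le> C * (\<Sum>m\<le>N. \<Sum>vs | set vs \<subseteq> Basis \<and> length vs \<le> N. schwartz_seminorm m vs \<phi>))"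

definition distribution_of ::
    "('a::euclidean_space \<Rightarrow> complex) \<Rightarrow> ('a \<Rightarrow> complex) \<Rightarrow> complex" where
  "distribution_of f \<phi> = (LINT x|lborel. f x * \<phi> x)"

text \<open>Integrability is required separately because a Bochner integral that does not exist
  has value \<open>0\<close>.\<close>

definition tempered_function :: "('a::euclidean_space \<Rightarrow> complex) \<Rightarrow> bool" where
  "tempered_function f \<longleftrightarrow>
     (\<forall>\<phi>. schwartz \<phi> \<longrightarrow> integrable lborel (\<lambda>x. f x * \<phi> x)) \<and>
     tempered_distribution (distribution_of f)"

section \<open>Fourier transform\<close>

definition fourier :: "('a::euclidean_space \<Rightarrow> complex) \<Rightarrow> 'a \<Rightarrow> complex" where
  "fourier \<phi> \<xi> = (LINT x|lborel. \<phi> x * exp (- (\<i> * complex_of_real (x \<bullet> \<xi>))))"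

definition distribution_fourier ::
    "(('a::euclidean_space \<Rightarrow> complex) \<Rightarrow> complex) \<Rightarrow> ('a \<Rightarrow> complex) \<Rightarrow> complex" where
  "distribution_fourier T \<phi> = T (fourier \<phi>)"

text \<open>The distributional Fourier transform of \<open>f\<close> is the function \<open>g\<close>. This determines \<open>g\<close> almost
  everywhere, hence pointwise on every open set on which \<open>g\<close> is continuous.\<close>

definition has_fourier_transform ::
    "('a::euclidean_space \<Rightarrow> complex) \<Rightarrow> ('a \<Rightarrow> complex) \<Rightarrow> bool" where
  "has_fourier_transform f g \<longleftrightarrow>
     tempered_function f \<and> tempered_function g \<and>
     (\<forall>\<phi>. schwartz \<phi> \<longrightarrow> distribution_fourier (distribution_of f) \<phi> = distribution_of g \<phi>)"

end

theory Submission
  imports Defs "HOL-Probability.Probability"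
begin

text \<open>Write \<open>N\<close> for the norming functional, so \<open>K = {N \<le> 1}\<close>, and \<open>m = n - 1\<close>. Since
  \<open>N x\<^bsup>-m\<^esup> = m \<integral> t\<^bsup>-n\<^esup> dt\<close> over \<open>t \<ge> N x\<close>, integrating a function \<open>w\<close> against \<open>N\<^bsup>-m\<^esup>\<close> amounts to
  integrating \<open>J(t) = \<integral>\<^sub>K w (t y) dy\<close> over \<open>t > 0\<close>, up to the factor \<open>m\<close>; no polar coordinates
  are needed. For \<open>w\<close> the Fourier transform of \<open>\<phi>\<close>, \<open>J\<close> is even; inserting the convergence factor
  \<open>exp (- (\<epsilon> t)\<^sup>2 / 2)\<close> and using Fubini's theorem turns \<open>\<integral> J\<close> over the line into \<open>2 \<pi>\<close> times the
  integral of \<open>\<phi>(\<xi>)\<close> against the integral over \<open>y \<in> K\<close> of the centred normal density of standard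
  deviation \<open>\<epsilon>\<close> at \<open>y \<bullet> \<xi>\<close>. For \<open>\<epsilon> \<longrightarrow> 0\<close> the latter tends to the section volume of \<open>K\<close> orthogonal to \<open>\<xi>\<close>
  divided by \<open>\<parallel>\<xi>\<parallel>\<close>, uniformly on the unit sphere.\<close>

section \<open>Layer cake formula for homogeneous weights\<close>

text \<open>The t-integral and the \<xi>-integral cannot be exchanged directly: \<open>N\<close> is
  merely continuous, so the transform of the indicator of K comes with no decay estimate, and on the
  whole line \<phi>(\<xi>) times a bounded oscillating factor is not absolutely integrable in (t,
  \<xi>). The Gaussian factor supplies integrability, and it can be removed because the layer cake
  formula already shows J to be integrable. On the other side the limit is dominated by a multiple
  of |\<phi>(\<xi>)| / |\<xi>|, which is integrable because n > 1. The constant is m * (1/2) * 2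
  \<pi> = \<pi> (n - 1): m from the layer cake, 1/2 from passing to the whole line, 2 \<pi> from the
  transform of the Gaussian. The volume on \<open>perp \<xi>\<close> is defined through a chosen
  basis that may jump with \<xi>, so continuity of the section volume has to come from the smoothed
  sections, which involve no basis. Finally the theorem speaks of every transform continuous off the
  origin, hence a separate uniqueness argument with Gaussian test functions.\<close>

lemma nn_integral_lborel_affine:
  fixes h :: "'a::euclidean_space \<Rightarrow> ennreal"
  assumes [measurable]: "h \<in> borel_measurable borel" and "c \<noteq> 0"
  shows "(\<integral>\<^sup>+x. h x \<partial>lborel) = ennreal (\<bar>c\<bar> ^ DIM('a)) * (\<integral>\<^sup>+x. h (t + c *\<^sub>R x) \<partial>lborel)"
  by (subst lborel_affine[OF \<open>c \<noteq> 0\<close>, of t])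
     (simp add: nn_integral_density nn_integral_distr nn_integral_cmult)

lemmas nn_integral_lborel_scale = nn_integral_lborel_affine[where t = 0, simplified]

lemma lborel_integral_affine:
  fixes h :: "'a::euclidean_space \<Rightarrow> 'b::{banach, second_countable_topology}"
  assumes [measurable]: "h \<in> borel_measurable borel" and "c \<noteq> 0"
  shows "(\<integral>x. h x \<partial>lborel) = (\<bar>c\<bar> ^ DIM('a)) *\<^sub>R (\<integral>x. h (t + c *\<^sub>R x) \<partial>lborel)"
  by (subst lborel_affine[OF \<open>c \<noteq> 0\<close>, of t])
     (simp add: integral_density integral_distr)

lemmas lborel_integral_scale = lborel_integral_affine[where t = 0, simplified]

lemma integrable_lborel_affine_iff:
  fixes h :: "'a::euclidean_space \<Rightarrow> 'b::{banach, second_countable_topology}"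
  assumes [measurable]: "h \<in> borel_measurable borel" and "c \<noteq> 0"
  shows "integrable lborel (\<lambda>x. h (t + c *\<^sub>R x)) \<longleftrightarrow> integrable lborel h"
proof -
  have "integrable lborel h \<longleftrightarrow>
      integrable (density (distr lborel borel (\<lambda>x. t + c *\<^sub>R x)) (\<lambda>_. ennreal (\<bar>c\<bar> ^ DIM('a)))) h"
    using lborel_affine[OF \<open>c \<noteq> 0\<close>, of t] by (simp add: ennreal_power)
  also have "\<dots> \<longleftrightarrow> integrable lborel (\<lambda>x. (\<bar>c\<bar> ^ DIM('a)) *\<^sub>R h (t + c *\<^sub>R x))"
    by (subst integrable_density) (simp_all add: integrable_distr_eq)
  also have "\<dots> \<longleftrightarrow> integrable lborel (\<lambda>x. h (t + c *\<^sub>R x))"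
    using \<open>c \<noteq> 0\<close> integrable_scaleR_right[of "inverse (\<bar>c\<bar> ^ DIM('a))" lborel "\<lambda>x. (\<bar>c\<bar> ^ DIM('a)) *\<^sub>R h (t + c *\<^sub>R x)"]
    by auto
  finally show ?thesis ..
qed

lemma nn_integral_inverse_power_atLeast:
  assumes "s > 0" and "m > 0"
  shows "(\<integral>\<^sup>+t. ennreal (real m * inverse (t ^ Suc m)) * indicator {s..} t \<partial>lborel)
           = ennreal (inverse (s ^ m))"
proof -
  obtain k where k: "m = Suc k" using \<open>m > 0\<close> by (cases m) auto
  have "(\<integral>\<^sup>+t. ennreal (real m * inverse (t ^ Suc m)) * indicator {s..} t \<partial>lborel)
      = ennreal (0 - (- inverse (s ^ m)))"
  proof (rule nn_integral_FTC_atLeast[where F = "\<lambda>t. - inverse (t ^ m)"])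
    fix x assume "s \<le> x"
    with \<open>s > 0\<close> have "x > 0" by simp
    then show "DERIV (\<lambda>t. - inverse (t ^ m)) x :> real m * inverse (x ^ Suc m)"
      by (auto intro!: derivative_eq_intros simp: k field_simps)
         (metis One_nat_def Suc_pred neq0_conv power_Suc)
    show "0 \<le> real m * inverse (x ^ Suc m)" using \<open>x > 0\<close> by simp
  next
    have "((\<lambda>t::real. - inverse (t ^ m)) \<longlongrightarrow> - 0) at_top"
      by (intro tendsto_minus tendsto_inverse_0_at_top filterlim_pow_at_top filterlim_ident) (simp add: \<open>m > 0\<close>)
    then show "((\<lambda>t::real. - inverse (t ^ m)) \<longlongrightarrow> 0) at_top" by simp
  qed simp
  then show ?thesis by simp
qed

text \<open>After Tonelli, substituting x = t y on the body of level t produces the Jacobian t ^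
  DIM, which cancels the density t^(-n) exactly because \<open>Suc m = DIM('a)\<close>; this is why
  t carries no weight in the first formula. The second formula is the stage before the substitution,
  kept for the integrability check in the complex version.\<close>

lemma layer_cake_nn_integral:
  fixes N :: "'a::euclidean_space \<Rightarrow> real" and w :: "'a \<Rightarrow> ennreal"
  assumes [measurable]: "N \<in> borel_measurable borel" "w \<in> borel_measurable borel"
    and pos: "\<And>x. x \<noteq> 0 \<Longrightarrow> N x > 0"
    and hom: "\<And>c x. N (c *\<^sub>R x) = \<bar>c\<bar> * N x"
    and m: "Suc m = DIM('a)" "m > 0"
  shows "(\<integral>\<^sup>+x. ennreal (inverse (N x ^ m)) * w x \<partial>lborel) =
     of_nat m * (\<integral>\<^sup>+t. indicator {0<..} t * (\<integral>\<^sup>+y. indicator {y. N y \<le> 1} y * w (t *\<^sub>R y) \<partial>lborel) \<partial>lborel)"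
    and "(\<integral>\<^sup>+x. ennreal (inverse (N x ^ m)) * w x \<partial>lborel) =
     (\<integral>\<^sup>+t. (\<integral>\<^sup>+x. ennreal (real m * inverse (t ^ Suc m)) * (indicator {0<..} t * indicator {x. N x \<le> t} x * w x) \<partial>lborel) \<partial>lborel)"
proof -
  have "(\<integral>\<^sup>+x. ennreal (inverse (N x ^ m)) * w x \<partial>lborel) =
     (\<integral>\<^sup>+x. (\<integral>\<^sup>+t. ennreal (real m * inverse (t ^ Suc m)) * (indicator {0<..} t * indicator {x. N x \<le> t} x * w x) \<partial>lborel) \<partial>lborel)"
  \<comment> \<open>At the origin the left side is 0 because \<open>inverse 0 = 0\<close>, while the
    inner integral is infinite when w does not vanish there. The identity therefore holds only off a
    null set.\<close>
  proof (rule nn_integral_cong_AE, use AE_lborel_singleton[of "0::'a"] in eventually_elim)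
    fix x :: 'a assume "x \<noteq> 0"
    then have "N x > 0" by (rule pos)
    have "(\<integral>\<^sup>+t. ennreal (real m * inverse (t ^ Suc m)) * (indicator {0<..} t * indicator {x. N x \<le> t} x * w x) \<partial>lborel)
       = (\<integral>\<^sup>+t. (ennreal (real m * inverse (t ^ Suc m)) * indicator {N x..} t) * w x \<partial>lborel)"
      using \<open>N x > 0\<close> by (intro nn_integral_cong) (auto simp: indicator_def)
    also have "\<dots> = ennreal (inverse (N x ^ m)) * w x"
      using nn_integral_inverse_power_atLeast[OF \<open>N x > 0\<close> \<open>m > 0\<close>]
      by (subst nn_integral_multc) simp_all
    finally show "ennreal (inverse (N x ^ m)) * w x =
       (\<integral>\<^sup>+t. ennreal (real m * inverse (t ^ Suc m)) * (indicator {0<..} t * indicator {x. N x \<le> t} x * w x) \<partial>lborel)"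
      by simp
  qed
  also have "\<dots> = (\<integral>\<^sup>+t. (\<integral>\<^sup>+x. ennreal (real m * inverse (t ^ Suc m)) * (indicator {0<..} t * indicator {x. N x \<le> t} x * w x) \<partial>lborel) \<partial>lborel)"
    by (rule lborel_pair.Fubini') measurable
  finally show *: "(\<integral>\<^sup>+x. ennreal (inverse (N x ^ m)) * w x \<partial>lborel) =
     (\<integral>\<^sup>+t. (\<integral>\<^sup>+x. ennreal (real m * inverse (t ^ Suc m)) * (indicator {0<..} t * indicator {x. N x \<le> t} x * w x) \<partial>lborel) \<partial>lborel)" .
  have "(\<integral>\<^sup>+x. ennreal (real m * inverse (t ^ Suc m)) * (indicator {0<..} t * indicator {x. N x \<le> t} x * w x) \<partial>lborel)
     = of_nat m * (indicator {0<..} t * (\<integral>\<^sup>+y. indicator {y. N y \<le> 1} y * w (t *\<^sub>R y) \<partial>lborel))" for t :: real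
  proof (cases "t > 0")
    case True
    have "(\<integral>\<^sup>+x. ennreal (real m * inverse (t ^ Suc m)) * (indicator {0<..} t * indicator {x. N x \<le> t} x * w x) \<partial>lborel)
       = ennreal (\<bar>t\<bar> ^ DIM('a)) * (\<integral>\<^sup>+x. ennreal (real m * inverse (t ^ Suc m)) * (indicator {0<..} t * indicator {x. N x \<le> t} (t *\<^sub>R x) * w (t *\<^sub>R x)) \<partial>lborel)"
      using True by (intro nn_integral_lborel_scale) auto
    also have "(\<integral>\<^sup>+x. ennreal (real m * inverse (t ^ Suc m)) * (indicator {0<..} t * indicator {x. N x \<le> t} (t *\<^sub>R x) * w (t *\<^sub>R x)) \<partial>lborel)
       = (\<integral>\<^sup>+x. ennreal (real m * inverse (t ^ Suc m)) * (indicator {y. N y \<le> 1} x * w (t *\<^sub>R x)) \<partial>lborel)"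
      using True by (intro nn_integral_cong) (auto simp: indicator_def hom mult_le_cancel_left1)
    also have "\<dots> = ennreal (real m * inverse (t ^ Suc m)) * (\<integral>\<^sup>+x. indicator {y. N y \<le> 1} x * w (t *\<^sub>R x) \<partial>lborel)"
      by (rule nn_integral_cmult) measurable
    also have "ennreal (\<bar>t\<bar> ^ DIM('a)) * \<dots> = ennreal (\<bar>t\<bar> ^ DIM('a) * (real m * inverse (t ^ Suc m))) * (\<integral>\<^sup>+x. indicator {y. N y \<le> 1} x * w (t *\<^sub>R x) \<partial>lborel)"
      using True by (subst ennreal_mult) (simp_all only: mult.assoc, simp_all)
    also have "\<bar>t\<bar> ^ DIM('a) * (real m * inverse (t ^ Suc m)) = real m"
      using True by (simp add: m(1)[symmetric] field_simps)
    finally show ?thesis using True by (simp add: ennreal_of_nat_eq_real_of_nat)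
  qed simp
  then show "(\<integral>\<^sup>+x. ennreal (inverse (N x ^ m)) * w x \<partial>lborel) =
     of_nat m * (\<integral>\<^sup>+t. indicator {0<..} t * (\<integral>\<^sup>+y. indicator {y. N y \<le> 1} y * w (t *\<^sub>R y) \<partial>lborel) \<partial>lborel)"
    unfolding * by (simp add: nn_integral_cmult)
qed

text \<open>Fubini's theorem for \<open>F\<close> is licensed by the second nonnegative formula
  applied to the norm of \<open>w\<close>, which returns the integral that is finite by
  assumption.\<close>

lemma layer_cake_integral:
  fixes N :: "'a::euclidean_space \<Rightarrow> real" and w :: "'a \<Rightarrow> complex"
  assumes [measurable]: "N \<in> borel_measurable borel" "w \<in> borel_measurable borel"
    and pos: "\<And>x. x \<noteq> 0 \<Longrightarrow> N x > 0"
    and hom: "\<And>c x. N (c *\<^sub>R x) = \<bar>c\<bar> * N x"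
    and m: "Suc m = DIM('a)" "m > 0"
    and int: "integrable lborel (\<lambda>x. inverse (N x ^ m) *\<^sub>R w x)"
  shows "integrable lborel (\<lambda>t. indicator {0<..} t *\<^sub>R (\<integral>y. indicator {y. N y \<le> 1} y *\<^sub>R w (t *\<^sub>R y) \<partial>lborel))" (is ?I)
    and "(\<integral>x. inverse (N x ^ m) *\<^sub>R w x \<partial>lborel) =
     real m *\<^sub>R (\<integral>t. indicator {0<..} t *\<^sub>R (\<integral>y. indicator {y. N y \<le> 1} y *\<^sub>R w (t *\<^sub>R y) \<partial>lborel) \<partial>lborel)" (is ?E)
proof -
  define F where "F = (\<lambda>t x. (real m * inverse (t ^ Suc m) * (indicator {0<..} t * indicator {x. N x \<le> t} x)) *\<^sub>R w x)"
  have [measurable]: "(\<lambda>(t, x). F t x) \<in> borel_measurable (lborel \<Otimes>\<^sub>M lborel)"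
    unfolding F_def by measurable
  have N0: "N x \<ge> 0" for x
    using pos[of x] hom[of 0 x] by (cases "x = 0") auto
  have F: "integrable (lborel \<Otimes>\<^sub>M lborel) (\<lambda>(t, x). F t x)"
  proof (rule integrableI_bounded)
    have "(\<integral>\<^sup>+p. norm (case p of (t, x) \<Rightarrow> F t x) \<partial>(lborel \<Otimes>\<^sub>M lborel))
        = (\<integral>\<^sup>+t. \<integral>\<^sup>+x. norm (F t x) \<partial>lborel \<partial>lborel)"
      by (subst lborel.nn_integral_fst[symmetric]) (auto simp: case_prod_unfold)
    also have "\<dots> = (\<integral>\<^sup>+t. (\<integral>\<^sup>+x. ennreal (real m * inverse (t ^ Suc m)) * (indicator {0<..} t * indicator {x. N x \<le> t} x * ennreal (norm (w x))) \<partial>lborel) \<partial>lborel)"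
      by (intro nn_integral_cong)
         (auto simp: F_def indicator_def abs_mult power_abs ennreal_mult')
    also have "\<dots> = (\<integral>\<^sup>+x. ennreal (inverse (N x ^ m)) * norm (w x) \<partial>lborel)"
      by (rule layer_cake_nn_integral(2)[symmetric]) (use pos hom m in auto)
    also have "\<dots> = (\<integral>\<^sup>+x. norm (inverse (N x ^ m) *\<^sub>R w x) \<partial>lborel)"
      by (intro nn_integral_cong) (simp add: ennreal_mult' N0)
    also have "\<dots> < \<infinity>"
      using int by (simp add: integrable_iff_bounded)
    finally show "(\<integral>\<^sup>+p. norm (case p of (t, x) \<Rightarrow> F t x) \<partial>(lborel \<Otimes>\<^sub>M lborel)) < \<infinity>" .
  qed measurable
  have t: "(\<integral>x. F t x \<partial>lborel) = real m *\<^sub>R (indicator {0<..} t *\<^sub>R (\<integral>y. indicator {y. N y \<le> 1} y *\<^sub>R w (t *\<^sub>R y) \<partial>lborel))" for t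
  proof (cases "t > 0")
    case True
    have "(\<integral>x. F t x \<partial>lborel) = (\<bar>t\<bar> ^ DIM('a)) *\<^sub>R (\<integral>x. F t (t *\<^sub>R x) \<partial>lborel)"
      using True by (intro lborel_integral_scale) (auto simp: F_def)
    also have "(\<integral>x. F t (t *\<^sub>R x) \<partial>lborel) = (\<integral>x. (real m * inverse (t ^ Suc m)) *\<^sub>R (indicator {y. N y \<le> 1} x *\<^sub>R w (t *\<^sub>R x)) \<partial>lborel)"
      using True by (intro Bochner_Integration.integral_cong) (auto simp: F_def indicator_def hom mult_le_cancel_left1)
    also have "\<dots> = (real m * inverse (t ^ Suc m)) *\<^sub>R (\<integral>x. indicator {y. N y \<le> 1} x *\<^sub>R w (t *\<^sub>R x) \<partial>lborel)"
      by (rule integral_scaleR_right)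
    finally show ?thesis using True by (simp add: m(1)[symmetric] field_simps)
  qed (simp add: F_def)
  have "integrable lborel (\<lambda>t. \<integral>x. F t x \<partial>lborel)"
    using lborel_pair.integrable_fst'[OF F] by simp
  then show ?I
    using \<open>m > 0\<close> integrable_scaleR_right[of "inverse (real m)" lborel "\<lambda>t. \<integral>x. F t x \<partial>lborel"]
    by (simp add: t mult.assoc[symmetric])
  have x: "AE x in lborel. (\<integral>t. F t x \<partial>lborel) = inverse (N x ^ m) *\<^sub>R w x"
    using AE_lborel_singleton[of "0::'a"]
  proof eventually_elim
    fix x :: 'a assume "x \<noteq> 0"
    then have "N x > 0" by (rule pos)
    have "(\<integral>t. F t x \<partial>lborel) = (\<integral>t. (real m * inverse (t ^ Suc m) * indicator {N x..} t) *\<^sub>R w x \<partial>lborel)"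
      using \<open>N x > 0\<close> by (intro Bochner_Integration.integral_cong) (auto simp: F_def indicator_def)
    also have "has_bochner_integral lborel (\<lambda>t. real m * inverse (t ^ Suc m) * indicator {N x..} t) (inverse (N x ^ m))"
    proof (rule has_bochner_integral_nn_integral)
      show "AE t in lborel. 0 \<le> real m * inverse (t ^ Suc m) * indicator {N x..} t"
        using \<open>N x > 0\<close> by (intro AE_I2) (auto simp: indicator_def)
      show "(\<integral>\<^sup>+t. ennreal (real m * inverse (t ^ Suc m) * indicator {N x..} t) \<partial>lborel) = ennreal (inverse (N x ^ m))"
        unfolding nn_integral_inverse_power_atLeast[OF \<open>N x > 0\<close> \<open>m > 0\<close>, symmetric]
        by (intro nn_integral_cong) (auto simp: indicator_def)
    qed (use \<open>N x > 0\<close> in auto)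
    then have "has_bochner_integral lborel (\<lambda>t. (real m * inverse (t ^ Suc m) * indicator {N x..} t) *\<^sub>R w x) (inverse (N x ^ m) *\<^sub>R w x)"
      by (rule has_bochner_integral_scaleR_left)
    then have "(\<integral>t. (real m * inverse (t ^ Suc m) * indicator {N x..} t) *\<^sub>R w x \<partial>lborel) = inverse (N x ^ m) *\<^sub>R w x"
      by (rule has_bochner_integral_integral_eq)
    finally show "(\<integral>t. F t x \<partial>lborel) = inverse (N x ^ m) *\<^sub>R w x" .
  qed
  have "(\<integral>x. inverse (N x ^ m) *\<^sub>R w x \<partial>lborel) = (\<integral>x. (\<integral>t. F t x \<partial>lborel) \<partial>lborel)"
    using x by (intro integral_cong_AE) (auto elim: eventually_mono)
  also have "\<dots> = (\<integral>t. (\<integral>x. F t x \<partial>lborel) \<partial>lborel)"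
    using F by (rule lborel_pair.Fubini_integral)
  finally show ?E by (simp only: t integral_scaleR_right)
qed

section \<open>Functions of moderate growth as tempered distributions\<close>

text \<open>The layer cake with \<open>N = norm\<close> and the ball indicator as weight: the inner
  integral is at most the ball volume B for t up to 1, and equals B t^(-n) beyond, so both pieces of
  the t-integral are finite.\<close>

lemma nn_integral_inverse_norm_power_cball:
  assumes m: "Suc m = DIM('a::euclidean_space)" "m > 0"
  shows "(\<integral>\<^sup>+(x::'a). ennreal (inverse (norm x ^ m)) * indicator (cball 0 1) x \<partial>lborel) < \<infinity>"
proof -
  define B where "B = emeasure lborel (cball (0::'a) 1)"
  have B: "B < \<infinity>" unfolding B_def using emeasure_lborel_cball_finite[of "0::'a" 1] by simp
  have *: "indicator {0<..} t * (\<integral>\<^sup>+(y::'a). indicator {y. norm y \<le> 1} y * indicator (cball 0 1) (t *\<^sub>R y) \<partial>lborel)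
      \<le> B * indicator {0..1} t + B * (ennreal (real m * inverse (t ^ Suc m)) * indicator {1..} t)"
    (is "?l * ?J \<le> _") for t
  proof (cases "t > 1")
    case True
    have "B = (\<integral>\<^sup>+y. indicator (cball (0::'a) 1) y \<partial>lborel)" by (simp add: B_def)
    also have "\<dots> = ennreal (\<bar>t\<bar> ^ DIM('a)) * (\<integral>\<^sup>+y. indicator (cball (0::'a) 1) (t *\<^sub>R y) \<partial>lborel)"
      using True by (intro nn_integral_lborel_scale borel_measurable_indicator) auto
    also have "(\<integral>\<^sup>+y. indicator (cball (0::'a) 1) (t *\<^sub>R y) \<partial>lborel) = ?J"
    proof (intro nn_integral_cong)
      fix y :: 'a
      have "norm y \<le> 1" if "\<bar>t\<bar> * norm y \<le> 1"
      proof -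
        have "1 * norm y \<le> \<bar>t\<bar> * norm y" using True by (intro mult_right_mono) auto
        with that show ?thesis by simp
      qed
      then show "indicator (cball 0 1) (t *\<^sub>R y) = (indicator {y. norm y \<le> 1} y * indicator (cball 0 1) (t *\<^sub>R y) :: ennreal)"
        by (auto simp: indicator_def)
    qed
    finally have "B = ennreal (t ^ Suc m) * ?J" using True by (simp add: m(1))
    then have "ennreal (inverse (t ^ Suc m)) * B = ennreal (inverse (t ^ Suc m)) * ennreal (t ^ Suc m) * ?J"
      by (simp add: mult.assoc)
    also have "ennreal (inverse (t ^ Suc m)) * ennreal (t ^ Suc m) = 1"
      using True by (subst ennreal_mult[symmetric]) (auto simp: field_simps)
    finally have "?J = 1 * (ennreal (inverse (t ^ Suc m)) * B)" by simp
    \<comment> \<open>The factor m \<ge> 1 is inserted so that the bound matches the density in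
      \<open>nn_integral_inverse_power_atLeast\<close>.\<close>
    also have "\<dots> \<le> of_nat m * (ennreal (inverse (t ^ Suc m)) * B)"
      using m(2) by (intro mult_right_mono) (simp_all add: Suc_le_eq)
    also have "\<dots> = B * ennreal (real m * inverse (t ^ Suc m))"
      using True by (subst ennreal_mult) (simp_all add: ennreal_of_nat_eq_real_of_nat mult.commute mult.left_commute del: power_Suc)
    finally show ?thesis using True by simp
  next
    case False
    have "?J \<le> (\<integral>\<^sup>+y. indicator (cball (0::'a) 1) y \<partial>lborel)"
      by (intro nn_integral_mono) (auto simp: indicator_def)
    also have "\<dots> = B" by (simp add: B_def)
    finally have "?J \<le> B" .
    with False show ?thesis by (auto simp: indicator_def add_increasing2)
  qed
  have "(\<integral>\<^sup>+(x::'a). ennreal (inverse (norm x ^ m)) * indicator (cball 0 1) x \<partial>lborel)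
      = of_nat m * (\<integral>\<^sup>+t. indicator {0<..} t * (\<integral>\<^sup>+(y::'a). indicator {y. norm y \<le> 1} y * indicator (cball 0 1) (t *\<^sub>R y) \<partial>lborel) \<partial>lborel)"
    by (rule layer_cake_nn_integral(1)[where N = norm and w = "indicator (cball 0 1)"])
       (use m in \<open>auto intro!: borel_measurable_indicator\<close>)
  also have "\<dots> \<le> of_nat m * (\<integral>\<^sup>+t. B * indicator {0..1} t + B * (ennreal (real m * inverse (t ^ Suc m)) * indicator {1..} t) \<partial>lborel)"
    by (intro mult_left_mono nn_integral_mono *) auto
  also have "\<dots> = of_nat m * (B + B)"
    using nn_integral_inverse_power_atLeast[of 1 m] m
    by (subst nn_integral_add) (auto simp: nn_integral_cmult simp del: power_Suc)
  also have "\<dots> < \<infinity>"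
    using B by (auto simp: ennreal_mult_less_top of_nat_less_top)
  finally show ?thesis .
qed

text \<open>The local singularity is that of \<open>\<parallel>x\<parallel>\<^bsup>-n+1\<^esup>\<close>, and the quadratic decay makes
  the weight integrable at infinity.\<close>

definition weight :: "'a::euclidean_space \<Rightarrow> real" where
  "weight x = inverse (norm x ^ (DIM('a) - 1)) * inverse (1 + (norm x)\<^sup>2)"

lemma weight_nonneg: "weight x \<ge> 0"
  by (simp add: weight_def)

lemma borel_measurable_weight[measurable]: "weight \<in> borel_measurable borel"
  unfolding weight_def[abs_def] by measurable

text \<open>The layer cake leaves 1 / (1 + t^2 |y|^2) over t > 0 and |y| \<le> 1. Integrating in t
  first gives \<pi> / (2 |y|), and since m \<ge> 1 this is at most (\<pi> / 2) |y|^(-m) on the unit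
  ball, the case just settled.\<close>

lemma integrable_weight:
  assumes "DIM('a::euclidean_space) > 1"
  shows "integrable lborel (weight :: 'a \<Rightarrow> real)"
proof (rule integrableI_bounded)
  define m where "m = DIM('a) - 1"
  have m: "Suc m = DIM('a)" "m > 0" using assms by (auto simp: m_def)
  have inner: "(\<integral>\<^sup>+t. indicator {0<..} t * ennreal (inverse (1 + (norm (t *\<^sub>R y))\<^sup>2)) \<partial>lborel)
      \<le> ennreal (pi / 2) * ennreal (inverse (norm y ^ m))" if "y \<noteq> 0" "norm y \<le> 1" for y :: 'a
  proof -
    have a: "norm y > 0" using that by simp
    have "(\<integral>\<^sup>+t. indicator {0<..} t * ennreal (inverse (1 + (norm (t *\<^sub>R y))\<^sup>2)) \<partial>lborel)
        \<le> (\<integral>\<^sup>+t. ennreal (inverse (1 + (norm (t *\<^sub>R y))\<^sup>2)) * indicator {0..} t \<partial>lborel)"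
      by (intro nn_integral_mono) (auto simp: indicator_def)
    also have "\<dots> = ennreal (inverse (norm y) * (pi / 2) - inverse (norm y) * arctan (norm y * 0))"
    proof (rule nn_integral_FTC_atLeast)
      fix t :: real
      show "((\<lambda>t. inverse (norm y) * arctan (norm y * t)) has_real_derivative inverse (1 + (norm (t *\<^sub>R y))\<^sup>2)) (at t)"
        using a by (auto intro!: derivative_eq_intros simp: power_mult_distrib ac_simps)
      have "filterlim (\<lambda>t. norm y * t) at_top at_top"
        using a by (intro filterlim_tendsto_pos_mult_at_top[OF tendsto_const]) (auto intro: filterlim_ident)
      then have "((\<lambda>t. arctan (norm y * t)) \<longlongrightarrow> pi / 2) at_top"
        by (rule filterlim_compose[OF tendsto_arctan_at_top])
      then show "((\<lambda>t. inverse (norm y) * arctan (norm y * t)) \<longlongrightarrow> inverse (norm y) * (pi / 2)) at_top"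
        by (intro tendsto_intros)
    qed (auto intro: add_nonneg_nonneg)
    also have "\<dots> \<le> ennreal (pi / 2 * inverse (norm y ^ m))"
    proof (intro ennreal_leI)
      have "norm y ^ m \<le> norm y ^ 1" using that m by (intro power_decreasing) auto
      then show "inverse (norm y) * (pi / 2) - inverse (norm y) * arctan (norm y * 0) \<le> pi / 2 * inverse (norm y ^ m)"
        using a by (simp add: field_simps)
    qed
    finally show ?thesis by (subst ennreal_mult[symmetric]) simp_all
  qed
  have "(\<integral>\<^sup>+(x::'a). norm (weight x) \<partial>lborel)
     = (\<integral>\<^sup>+(x::'a). ennreal (inverse (norm x ^ m)) * ennreal (inverse (1 + (norm x)\<^sup>2)) \<partial>lborel)"
    unfolding m_def by (intro nn_integral_cong) (simp add: weight_def ennreal_mult[symmetric])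
  also have "\<dots> = of_nat m * (\<integral>\<^sup>+t. indicator {0<..} t * (\<integral>\<^sup>+(y::'a). indicator {y. norm y \<le> 1} y * ennreal (inverse (1 + (norm (t *\<^sub>R y))\<^sup>2)) \<partial>lborel) \<partial>lborel)"
    by (rule layer_cake_nn_integral(1)) (use m in auto)
  also have "(\<integral>\<^sup>+t. indicator {0<..} t * (\<integral>\<^sup>+(y::'a). indicator {y. norm y \<le> 1} y * ennreal (inverse (1 + (norm (t *\<^sub>R y))\<^sup>2)) \<partial>lborel) \<partial>lborel)
     = (\<integral>\<^sup>+t. (\<integral>\<^sup>+(y::'a). indicator {0<..} t * (indicator {y. norm y \<le> 1} y * ennreal (inverse (1 + (norm (t *\<^sub>R y))\<^sup>2))) \<partial>lborel) \<partial>lborel)"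
    by (intro nn_integral_cong nn_integral_cmult[symmetric]) measurable
  also have "\<dots> = (\<integral>\<^sup>+(y::'a). (\<integral>\<^sup>+t. indicator {0<..} t * (indicator {y. norm y \<le> 1} y * ennreal (inverse (1 + (norm (t *\<^sub>R y))\<^sup>2))) \<partial>lborel) \<partial>lborel)"
    by (rule lborel_pair.Fubini') measurable
  also have "\<dots> \<le> (\<integral>\<^sup>+(y::'a). ennreal (pi / 2) * (ennreal (inverse (norm y ^ m)) * indicator (cball 0 1) y) \<partial>lborel)"
  proof (rule nn_integral_mono_AE, use AE_lborel_singleton[of "0::'a"] in eventually_elim)
    fix y :: 'a assume "y \<noteq> 0"
    then show "(\<integral>\<^sup>+t. indicator {0<..} t * (indicator {y. norm y \<le> 1} y * ennreal (inverse (1 + (norm (t *\<^sub>R y))\<^sup>2))) \<partial>lborel)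
        \<le> ennreal (pi / 2) * (ennreal (inverse (norm y ^ m)) * indicator (cball 0 1) y)"
      using inner[of y] by (cases "norm y \<le> 1") auto
  qed
  also have "\<dots> = ennreal (pi / 2) * (\<integral>\<^sup>+(y::'a). (ennreal (inverse (norm y ^ m)) * indicator (cball 0 1) y) \<partial>lborel)"
    by (rule nn_integral_cmult) (intro borel_measurable_times_ennreal borel_measurable_indicator; simp)
  finally have "(\<integral>\<^sup>+(x::'a). norm (weight x) \<partial>lborel) \<le> of_nat m * (ennreal (pi / 2) * (\<integral>\<^sup>+(y::'a). (ennreal (inverse (norm y ^ m)) * indicator (cball 0 1) y) \<partial>lborel))"
    by (simp add: mult_left_mono)
  also have "\<dots> < \<infinity>"
    using nn_integral_inverse_norm_power_cball[OF m]
    by (auto simp: ennreal_mult_less_top of_nat_less_top)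
  finally show "(\<integral>\<^sup>+(x::'a). norm (weight x) \<partial>lborel) < \<infinity>" .
qed simp

section \<open>Schwartz functions paired with functions of moderate growth\<close>

lemma schwartz_iter_deriv:
  assumes "schwartz \<phi>" "set vs \<subseteq> Basis"
  shows "iter_deriv vs \<phi> differentiable (at x)"
    and "continuous_on UNIV (iter_deriv vs \<phi>)"
    and "iter_deriv vs \<phi> \<in> borel_measurable borel"
    and "norm x ^ k * norm (iter_deriv vs \<phi> x) \<le> schwartz_seminorm k vs \<phi>"
proof -
  show *: "iter_deriv vs \<phi> differentiable (at x)" for x
    using assms by (auto simp: schwartz_def smooth_def)
  show "continuous_on UNIV (iter_deriv vs \<phi>)"
    using * by (auto simp: continuous_on_eq_continuous_at intro: differentiable_imp_continuous_within)
  then show "iter_deriv vs \<phi> \<in> borel_measurable borel"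
    by (rule borel_measurable_continuous_onI)
  have "bounded (range (\<lambda>x. norm x ^ k *\<^sub>R iter_deriv vs \<phi> x))"
    using assms by (auto simp: schwartz_def)
  then obtain C where "\<And>x. norm (norm x ^ k *\<^sub>R iter_deriv vs \<phi> x) \<le> C"
    by (auto simp: bounded_iff)
  \<comment> \<open>A supremum over the reals dominates its members only when the range is bounded
    above.\<close>
  then have "bdd_above (range (\<lambda>x. norm x ^ k * norm (iter_deriv vs \<phi> x)))"
    by (auto simp: bdd_above_def)
  then show "norm x ^ k * norm (iter_deriv vs \<phi> x) \<le> schwartz_seminorm k vs \<phi>"
    unfolding schwartz_seminorm_def by (rule cSUP_upper[OF UNIV_I])
qed

lemma schwartz_seminorm_nonneg:
  assumes "schwartz \<phi>" "set vs \<subseteq> Basis"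
  shows "schwartz_seminorm k vs \<phi> \<ge> 0"
  using schwartz_iter_deriv(4)[OF assms, of 0 k] by (rule order_trans[rotated]) auto

text \<open>The four seminorms are the terms of the expanded product (1 + |x|^k) (1 + |x|^2); the
  second factor is traded for the quadratic decay in \<open>weight\<close>.\<close>

lemma schwartz_weight_bound:
  fixes \<phi> :: "'a::euclidean_space \<Rightarrow> complex"
  assumes "schwartz \<phi>" "set vs \<subseteq> Basis" and "x \<noteq> 0"
    and h: "h \<ge> 0" "h \<le> C * inverse (norm x ^ (DIM('a) - 1)) * (1 + norm x ^ k)"
  shows "h * norm (iter_deriv vs \<phi> x) \<le>
    C * (schwartz_seminorm 0 vs \<phi> + schwartz_seminorm 2 vs \<phi> + schwartz_seminorm k vs \<phi> + schwartz_seminorm (k + 2) vs \<phi>) * weight x"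
proof -
  note b = schwartz_iter_deriv(4)[OF assms(1,2), of x]
  let ?D = "norm (iter_deriv vs \<phi> x)" and ?i = "inverse (norm x ^ (DIM('a) - 1))"
  let ?S = "schwartz_seminorm 0 vs \<phi> + schwartz_seminorm 2 vs \<phi> + schwartz_seminorm k vs \<phi> + schwartz_seminorm (k + 2) vs \<phi>"
  \<comment> \<open>The sign of \<open>C\<close> is forced: h is nonnegative and, as x is not 0, the
    factor next to \<open>C\<close> is positive.\<close>
  have "C \<ge> 0"
  proof (rule ccontr)
    assume "\<not> C \<ge> 0"
    then have "C * (?i * (1 + norm x ^ k)) < 0"
      using \<open>x \<noteq> 0\<close> by (intro mult_neg_pos) (auto intro!: mult_pos_pos add_pos_nonneg)
    with h show False by (simp add: mult.assoc)
  qed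
  have "(1 + norm x ^ k) * (1 + (norm x)\<^sup>2) * ?D \<le> ?S"
    using b[of 0] b[of 2] b[of k] b[of "k + 2"] by (simp add: algebra_simps power_add power2_eq_square)
  then have "(1 + norm x ^ k) * ?D \<le> ?S * inverse (1 + (norm x)\<^sup>2)"
    by (subst divide_inverse[symmetric], subst pos_le_divide_eq) (auto intro: add_pos_nonneg simp: ac_simps)
  then have "C * ?i * ((1 + norm x ^ k) * ?D) \<le> C * ?i * (?S * inverse (1 + (norm x)\<^sup>2))"
    using \<open>C \<ge> 0\<close> by (intro mult_left_mono) auto
  moreover have "h * ?D \<le> C * ?i * (1 + norm x ^ k) * ?D"
    using h by (intro mult_right_mono) auto
  ultimately show ?thesis by (simp add: weight_def ac_simps)
qed

text \<open>The growth condition admits both a singularity of order n - 1 at the origin and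
  polynomial growth at infinity, so it covers the gauge power as well as its transform. The explicit
  bound yields continuity as a distribution.\<close>

lemma integrable_mult_iter_deriv:
  fixes \<phi> :: "'a::euclidean_space \<Rightarrow> complex" and h :: "'a \<Rightarrow> complex"
  assumes "DIM('a) > 1" "schwartz \<phi>" "set vs \<subseteq> Basis" and [measurable]: "h \<in> borel_measurable borel"
    and h: "\<And>x. x \<noteq> 0 \<Longrightarrow> norm (h x) \<le> C * inverse (norm x ^ (DIM('a) - 1)) * (1 + norm x ^ k)"
  shows "integrable lborel (\<lambda>x. h x * iter_deriv vs \<phi> x)"
    and "norm (\<integral>x. h x * iter_deriv vs \<phi> x \<partial>lborel) \<le>
      C * (schwartz_seminorm 0 vs \<phi> + schwartz_seminorm 2 vs \<phi> + schwartz_seminorm k vs \<phi> + schwartz_seminorm (k + 2) vs \<phi>)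
        * (\<integral>x. weight (x::'a) \<partial>lborel)"
proof -
  let ?S = "schwartz_seminorm 0 vs \<phi> + schwartz_seminorm 2 vs \<phi> + schwartz_seminorm k vs \<phi> + schwartz_seminorm (k + 2) vs \<phi>"
  have [measurable]: "iter_deriv vs \<phi> \<in> borel_measurable borel"
    using assms by (intro schwartz_iter_deriv)
  have b: "AE x in lborel. norm (h x * iter_deriv vs \<phi> x) \<le> C * ?S * weight x"
    using AE_lborel_singleton[of "0::'a"]
    by eventually_elim (simp only: norm_mult, rule schwartz_weight_bound, use assms in auto)
  have W: "integrable lborel (\<lambda>x::'a. C * ?S * weight x)"
    using integrable_weight[OF assms(1)] by simp
  show i: "integrable lborel (\<lambda>x. h x * iter_deriv vs \<phi> x)"
  proof (rule Bochner_Integration.integrable_bound[OF W])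
    show "AE x in lborel. norm (h x * iter_deriv vs \<phi> x) \<le> norm (C * ?S * weight x)"
      using b by eventually_elim (simp add: order_trans[OF _ abs_ge_self])
  qed measurable
  have "norm (\<integral>x. h x * iter_deriv vs \<phi> x \<partial>lborel) \<le> (\<integral>x. norm (h x * iter_deriv vs \<phi> x) \<partial>lborel)"
    by (rule integral_norm_bound)
  also have "\<dots> \<le> (\<integral>x. C * ?S * weight (x::'a) \<partial>lborel)"
    by (rule integral_mono_AE[OF integrable_norm[OF i] W b])
  finally
  show "norm (\<integral>x. h x * iter_deriv vs \<phi> x \<partial>lborel) \<le> C * ?S * (\<integral>x. weight (x::'a) \<partial>lborel)"
    by simp
qed

lemma schwartz_integrable:
  fixes \<phi> :: "'a::euclidean_space \<Rightarrow> complex"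
  assumes "DIM('a) > 1" "schwartz \<phi>" "set vs \<subseteq> Basis"
  shows "integrable lborel (iter_deriv vs \<phi>)"
proof -
  have "integrable lborel (\<lambda>x. 1 * iter_deriv vs \<phi> x)"
  \<comment> \<open>With this k the admissible bound is |x|^(-n+1) + 1, which majorizes the constant
    function 1.\<close>
  proof (rule integrable_mult_iter_deriv[OF assms, where C = 1 and k = "DIM('a) - 1"])
    fix x :: 'a assume "x \<noteq> 0"
    then show "norm (1::complex) \<le> 1 * inverse (norm x ^ (DIM('a) - 1)) * (1 + norm x ^ (DIM('a) - 1))"
      by (simp add: field_simps)
  qed simp
  then show ?thesis by simp
qed

lemma tempered_functionI:
  fixes h :: "'a::euclidean_space \<Rightarrow> complex"
  assumes n: "DIM('a) > 1" and [measurable]: "h \<in> borel_measurable borel"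
    and h: "\<And>x. x \<noteq> 0 \<Longrightarrow> norm (h x) \<le> C * inverse (norm x ^ (DIM('a) - 1)) * (1 + norm x ^ k)"
  shows "tempered_function h"
proof -
  note i = integrable_mult_iter_deriv(1)[OF n _ _ assms(2) h, where vs = "[]", simplified]
  note b = integrable_mult_iter_deriv(2)[OF n _ _ assms(2) h, where vs = "[]", simplified]
  let ?I = "\<integral>x. weight (x::'a) \<partial>lborel"
  have I: "?I \<ge> 0" by (intro Bochner_Integration.integral_nonneg weight_nonneg)
  obtain b :: 'a where "b \<in> Basis" using nonempty_Basis by blast
  \<comment> \<open>At a unit vector the growth bound reads 2 C, which shows that \<open>C\<close>
    is nonnegative.\<close>
  have "norm (h b) \<le> 2 * C" using h[of b] \<open>b \<in> Basis\<close> by (auto simp: nonzero_Basis)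
  then have C: "C \<ge> 0" using norm_ge_zero[of "h b"] by linarith
  \<comment> \<open>The largest power of the norm among the four seminorms. Only the empty
    multi-index occurs; the other summands enlarge the sum because they are nonnegative.\<close>
  let ?N = "k + 2"
  have "norm (distribution_of h \<phi>) \<le> (4 * C * ?I) * (\<Sum>m\<le>?N. \<Sum>vs | set vs \<subseteq> Basis \<and> length vs \<le> ?N. schwartz_seminorm m vs \<phi>)"
    if \<phi>: "schwartz \<phi>" for \<phi>
  proof -
    let ?V = "{vs. set vs \<subseteq> (Basis::'a set) \<and> length vs \<le> ?N}"
    have fin: "finite ?V" by (intro finite_lists_length_le) simp
    have s: "schwartz_seminorm j [] \<phi> \<le> (\<Sum>m\<le>?N. \<Sum>vs\<in>?V. schwartz_seminorm m vs \<phi>)" if "j \<le> ?N" for j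
    proof -
      have "schwartz_seminorm j [] \<phi> \<le> (\<Sum>vs\<in>?V. schwartz_seminorm j vs \<phi>)"
        using fin by (intro member_le_sum) (auto intro: schwartz_seminorm_nonneg \<phi>)
      also have "\<dots> \<le> (\<Sum>m\<le>?N. \<Sum>vs\<in>?V. schwartz_seminorm m vs \<phi>)"
        using that by (intro member_le_sum[where f = "\<lambda>m. \<Sum>vs\<in>?V. schwartz_seminorm m vs \<phi>"])
          (auto intro!: sum_nonneg schwartz_seminorm_nonneg \<phi>)
      finally show ?thesis .
    qed
    have "norm (distribution_of h \<phi>) \<le>
       C * (schwartz_seminorm 0 [] \<phi> + schwartz_seminorm 2 [] \<phi> + schwartz_seminorm k [] \<phi> + schwartz_seminorm ?N [] \<phi>) * ?I"
      unfolding distribution_of_def using b[OF \<phi>] by simp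
    also have "\<dots> \<le> C * (4 * (\<Sum>m\<le>?N. \<Sum>vs\<in>?V. schwartz_seminorm m vs \<phi>)) * ?I"
      using s[of 0] s[of 2] s[of k] s[of ?N] C I by (intro mult_right_mono mult_left_mono) auto
    finally show ?thesis by (simp add: ac_simps)
  qed
  then have "\<exists>C N. \<forall>\<phi>. schwartz \<phi> \<longrightarrow>
      norm (distribution_of h \<phi>) \<le> C * (\<Sum>m\<le>N. \<Sum>vs | set vs \<subseteq> Basis \<and> length vs \<le> N. schwartz_seminorm m vs \<phi>)"
    by blast
  then show ?thesis
    unfolding tempered_function_def tempered_distribution_def
    by (simp add: distribution_of_def distrib_left i mult.left_commute[of "h _"])
qed

section \<open>Rotation invariance and slicing of Lebesgue measure\<close>

text \<open>Checked on boxes, where it factors into one-dimensional substitutions. The case r = 1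
  gives translation invariance in orthonormal coordinates, the case t = 0 the scaling of central
  slices.\<close>

lemma nn_integral_PiM_lborel_affine:
  fixes t :: "'i \<Rightarrow> real" and r :: real
  assumes "finite B" "r \<noteq> 0" and f[measurable]: "f \<in> borel_measurable (\<Pi>\<^sub>M b\<in>B. lborel)"
  shows "(\<integral>\<^sup>+c. f c \<partial>(\<Pi>\<^sub>M b\<in>B. lborel)) =
    ennreal (\<bar>r\<bar> ^ card B) * (\<integral>\<^sup>+c. f (\<lambda>b\<in>B. t b + r * c b) \<partial>(\<Pi>\<^sub>M b\<in>B. lborel))"
proof -
  interpret product_sigma_finite "\<lambda>_. lborel :: real measure" by standard
  let ?P = "\<Pi>\<^sub>M b\<in>B. (lborel :: real measure)"
  let ?T = "\<lambda>c. \<lambda>b\<in>B. t b + r * c b"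
  have T[measurable]: "?T \<in> measurable ?P ?P" by measurable
  have "density (distr ?P ?P ?T) (\<lambda>_. ennreal (\<bar>r\<bar> ^ card B)) = ?P"
  proof (rule PiM_eqI)
    fix A :: "'i \<Rightarrow> real set" assume A: "\<And>i. i \<in> B \<Longrightarrow> A i \<in> sets lborel"
    have [measurable]: "Pi\<^sub>E B A \<in> sets ?P" using A \<open>finite B\<close> by (intro sets_PiM_I_finite) auto
    have A': "(\<lambda>x. t b + r * x) -` A b \<in> sets lborel" if "b \<in> B" for b
    proof -
      have "(\<lambda>x. t b + r * x) -` A b \<inter> space borel \<in> sets borel"
        using A[OF that] by (intro measurable_sets[where A = borel]) auto
      then show ?thesis by simp
    qed
    have "emeasure (density (distr ?P ?P ?T) (\<lambda>_. ennreal (\<bar>r\<bar> ^ card B))) (Pi\<^sub>E B A)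
        = ennreal (\<bar>r\<bar> ^ card B) * emeasure ?P (?T -` Pi\<^sub>E B A \<inter> space ?P)"
      by (simp add: emeasure_density nn_integral_cmult emeasure_distr)
    also have "?T -` Pi\<^sub>E B A \<inter> space ?P = Pi\<^sub>E B (\<lambda>b. (\<lambda>x. t b + r * x) -` A b)"
      by (auto simp: space_PiM PiE_iff)
    also have "emeasure ?P \<dots> = (\<Prod>b\<in>B. emeasure lborel ((\<lambda>x. t b + r * x) -` A b))"
      using \<open>finite B\<close> A' by (intro emeasure_PiM) auto
    also have "ennreal (\<bar>r\<bar> ^ card B) * \<dots> = (\<Prod>b\<in>B. ennreal \<bar>r\<bar> * emeasure lborel ((\<lambda>x. t b + r * x) -` A b))"
      by (simp add: prod.distrib ennreal_power)
    also have "\<dots> = (\<Prod>b\<in>B. emeasure lborel (A b))"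
    proof (rule prod.cong[OF refl])
      fix b assume "b \<in> B"
      have [measurable]: "A b \<in> sets borel" using A[OF \<open>b \<in> B\<close>] by simp
      have "emeasure lborel (A b) = (\<integral>\<^sup>+x. indicator (A b) x \<partial>lborel)" by simp
      also have "\<dots> = ennreal \<bar>r\<bar> * (\<integral>\<^sup>+x. indicator (A b) (t b + r * x) \<partial>lborel)"
        using \<open>r \<noteq> 0\<close> by (intro nn_integral_real_affine) auto
      also have "(\<integral>\<^sup>+x. indicator (A b) (t b + r * x) \<partial>lborel)
          = (\<integral>\<^sup>+x. indicator ((\<lambda>x. t b + r * x) -` A b) x \<partial>lborel)"
        by (intro nn_integral_cong) (simp add: indicator_def)
      also have "\<dots> = emeasure lborel ((\<lambda>x. t b + r * x) -` A b)"
        using A'[OF \<open>b \<in> B\<close>] by simp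
      finally show "ennreal \<bar>r\<bar> * emeasure lborel ((\<lambda>x. t b + r * x) -` A b) = emeasure lborel (A b)" ..
    qed
    finally show "emeasure (density (distr ?P ?P ?T) (\<lambda>_. ennreal (\<bar>r\<bar> ^ card B))) (Pi\<^sub>E B A)
       = (\<Prod>b\<in>B. emeasure lborel (A b))" .
  qed (use \<open>finite B\<close> in simp_all)
  then have "integral\<^sup>N ?P f = integral\<^sup>N (density (distr ?P ?P ?T) (\<lambda>_. ennreal (\<bar>r\<bar> ^ card B))) f"
    by simp
  also have "\<dots> = ennreal (\<bar>r\<bar> ^ card B) * (\<integral>\<^sup>+c. f (?T c) \<partial>?P)"
    by (simp add: nn_integral_density nn_integral_distr nn_integral_cmult)
  finally show ?thesis .
qed

lemma orthonormal_basis_of_facts: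
  fixes B :: "'a::euclidean_space set"
  assumes "orthonormal_basis_of S B"
  shows "finite B" "card B = dim S" "B \<subseteq> S"
    and "(norm (\<Sum>b\<in>B. c b *\<^sub>R b))\<^sup>2 = (\<Sum>b\<in>B. (c b)\<^sup>2)"
    and "x \<in> S \<Longrightarrow> \<exists>c. x = (\<Sum>b\<in>B. c b *\<^sub>R b)"
proof -
  have B: "pairwise orthogonal B" "\<And>b. b \<in> B \<Longrightarrow> norm b = 1" "span B = S"
    using assms by (auto simp: orthonormal_basis_of_def)
  have ind: "independent B"
    using B by (intro pairwise_orthogonal_independent) force+
  then show "finite B" by (rule independent_imp_finite)
  show "card B = dim S" using ind B(3) dim_span_eq_card_independent by metis
  show "B \<subseteq> S" using B(3) span_superset by blast
  have "pairwise (\<lambda>i j. orthogonal (c i *\<^sub>R i) (c j *\<^sub>R j)) B"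
    using B(1) by (auto simp: pairwise_def orthogonal_def)
  from norm_sum_Pythagorean[OF \<open>finite B\<close> this]
  show "(norm (\<Sum>b\<in>B. c b *\<^sub>R b))\<^sup>2 = (\<Sum>b\<in>B. (c b)\<^sup>2)"
    using B(2) by simp
  show "\<exists>c. x = (\<Sum>b\<in>B. c b *\<^sub>R b)" if "x \<in> S"
    using that \<open>finite B\<close> B(3) by (auto simp: span_finite)
qed

text \<open>Both sides are translation invariant functionals of \<open>f\<close>, so Fubini's theorem makes them
  proportional; the factor is read off from the unit ball.\<close>

lemma nn_integral_orthonormal_basis:
  fixes B :: "'a::euclidean_space set" and f :: "'a \<Rightarrow> ennreal"
  assumes B: "orthonormal_basis_of UNIV B" and f[measurable]: "f \<in> borel_measurable borel"
  shows "(\<integral>\<^sup>+c. f (\<Sum>b\<in>B. c b *\<^sub>R b) \<partial>(\<Pi>\<^sub>M b\<in>B. lborel)) = (\<integral>\<^sup>+x. f x \<partial>lborel)"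
proof -
  interpret product_sigma_finite "\<lambda>_. lborel :: real measure" by standard
  define P where "P = (\<Pi>\<^sub>M b\<in>B. (lborel :: real measure))"
  define \<Phi> where "\<Phi> = (\<lambda>c. \<Sum>b\<in>B. c b *\<^sub>R b)"
  note BF = orthonormal_basis_of_facts[OF B]
  have [measurable]: "\<Phi> \<in> borel_measurable P" unfolding P_def \<Phi>_def by measurable
  interpret P: sigma_finite_measure P unfolding P_def using BF(1) by (rule sigma_finite)
  interpret PL: pair_sigma_finite P "lborel :: 'a measure" ..
  let ?g = "indicator (cball (0::'a) 1) :: 'a \<Rightarrow> ennreal"
  have [measurable]: "?g \<in> borel_measurable borel" by (intro borel_measurable_indicator) simp
  let ?F = "\<lambda>h. \<integral>\<^sup>+c. h (\<Phi> c) \<partial>P"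
  have shift: "(\<integral>\<^sup>+c. h (\<Phi> c + v) \<partial>P) = (\<integral>\<^sup>+c. h (\<Phi> c) \<partial>P)"
    if [measurable]: "h \<in> borel_measurable borel" for h :: "'a \<Rightarrow> ennreal" and v
  proof -
    obtain t where t: "v = (\<Sum>b\<in>B. t b *\<^sub>R b)" using BF(5)[of v] by auto
    have "(\<integral>\<^sup>+c. h (\<Phi> c) \<partial>P) = ennreal (\<bar>1\<bar> ^ card B) * (\<integral>\<^sup>+c. h (\<Phi> (\<lambda>b\<in>B. t b + 1 * c b)) \<partial>P)"
      unfolding P_def by (intro nn_integral_PiM_lborel_affine BF) (simp_all add: \<Phi>_def)
    also have "(\<lambda>c. \<Phi> (\<lambda>b\<in>B. t b + 1 * c b)) = (\<lambda>c. \<Phi> c + v)"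
      by (simp add: \<Phi>_def t fun_eq_iff scaleR_add_left sum.distrib add.commute)
    finally show ?thesis by (simp add: fun_eq_iff)
  qed
  have g: "(\<integral>\<^sup>+y. ?g (v + y) \<partial>lborel) = (\<integral>\<^sup>+y. ?g y \<partial>lborel)" for v
    using nn_integral_lborel_affine[of ?g 1 v] by simp
  have f': "(\<integral>\<^sup>+y. f (v - y) \<partial>lborel) = (\<integral>\<^sup>+y. f y \<partial>lborel)" for v
    using nn_integral_lborel_affine[of f "-1" v] by simp
  \<comment> \<open>The product of the two integrals is written as a double integral whose inner
    integral of \<open>?g\<close> is independent of c. Shifting c by y, and then reflecting and
    shifting y, moves the roles of f and the ball indicator to the other measure.\<close>
  have "?F f * (\<integral>\<^sup>+y. ?g y \<partial>lborel) = (\<integral>\<^sup>+c. (\<integral>\<^sup>+y. f (\<Phi> c) * ?g (\<Phi> c + y) \<partial>lborel) \<partial>P)"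
    by (simp add: nn_integral_cmult nn_integral_multc g)
  also have "\<dots> = (\<integral>\<^sup>+y. (\<integral>\<^sup>+c. f (\<Phi> c) * ?g (\<Phi> c + y) \<partial>P) \<partial>lborel)"
    by (rule PL.Fubini'[symmetric]) measurable
  also have "\<dots> = (\<integral>\<^sup>+y. (\<integral>\<^sup>+c. f (\<Phi> c - y) * ?g (\<Phi> c) \<partial>P) \<partial>lborel)"
  proof (rule nn_integral_cong)
    fix y :: 'a
    show "(\<integral>\<^sup>+c. f (\<Phi> c) * ?g (\<Phi> c + y) \<partial>P) = (\<integral>\<^sup>+c. f (\<Phi> c - y) * ?g (\<Phi> c) \<partial>P)"
      using shift[of "\<lambda>z. f (z - y) * ?g z" y] by simp
  qed
  also have "\<dots> = (\<integral>\<^sup>+c. (\<integral>\<^sup>+y. f (\<Phi> c - y) * ?g (\<Phi> c) \<partial>lborel) \<partial>P)"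
    by (rule PL.Fubini') measurable
  also have "\<dots> = (\<integral>\<^sup>+x. f x \<partial>lborel) * ?F ?g"
    by (simp add: nn_integral_cmult nn_integral_multc f')
  \<comment> \<open>By Pythagoras the unit ball has the same description in every orthonormal
    coordinate system, and its volume depends only on the number of coordinates.\<close>
  also have "?F ?g = emeasure P ({c. sqrt (\<Sum>i\<in>B. (c i)\<^sup>2) \<le> 1} \<inter> space P)"
  proof -
    have "?F ?g = (\<integral>\<^sup>+c. indicator ({c. sqrt (\<Sum>i\<in>B. (c i)\<^sup>2) \<le> 1} \<inter> space P) c \<partial>P)"
      by (intro nn_integral_cong) (auto simp: indicator_def \<Phi>_def BF(4)[symmetric])
    also have "\<dots> = emeasure P ({c. sqrt (\<Sum>i\<in>B. (c i)\<^sup>2) \<le> 1} \<inter> space P)"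
      by (intro nn_integral_indicator) (simp add: P_def, measurable)
    finally show ?thesis .
  qed
  also have "\<dots> = (\<integral>\<^sup>+y. ?g y \<partial>lborel)"
    using emeasure_cball_aux[OF BF(1), of 1] emeasure_cball[of 1 "0::'a"] by (simp add: P_def BF(2))
  finally have "(\<integral>\<^sup>+y. ?g y \<partial>lborel) * ?F f = (\<integral>\<^sup>+y. ?g y \<partial>lborel) * (\<integral>\<^sup>+x. f x \<partial>lborel)"
    by (simp add: mult.commute)
  moreover have "0 < (\<integral>\<^sup>+y. ?g y \<partial>lborel)" "(\<integral>\<^sup>+y. ?g y \<partial>lborel) < top"
    using emeasure_cball[of 1 "0::'a"] by simp_all
  ultimately have "?F f = (\<integral>\<^sup>+x. f x \<partial>lborel)"
    by (auto simp: ennreal_mult_cancel_left less_top[symmetric])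
  then show ?thesis by (simp add: P_def \<Phi>_def)
qed

section \<open>Hyperplanes through the origin and integration along a unit normal\<close>

lemma subspace_perp: "subspace (perp \<xi>)"
  by (auto simp: perp_def subspace_def inner_add_left)

lemma orthonormal_basis_of_perp_exists: "\<exists>B. orthonormal_basis_of (perp \<xi>) B"
  by (metis orthonormal_basis_of_def orthonormal_basis_subspace subspace_perp)

lemma orthonormal_basis_insert_perp:
  fixes \<xi> :: "'a::euclidean_space"
  assumes B: "orthonormal_basis_of (perp \<xi>) B" and "norm \<xi> = 1"
  shows "orthonormal_basis_of UNIV (insert \<xi> B)" and "\<xi> \<notin> B" and "Suc (card B) = DIM('a)"
proof -
  have B': "pairwise orthogonal B" "\<And>b. b \<in> B \<Longrightarrow> norm b = 1" "span B = perp \<xi>"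
    using B by (auto simp: orthonormal_basis_of_def)
  have perp: "b \<bullet> \<xi> = 0" if "b \<in> B" for b
    using orthonormal_basis_of_facts(3)[OF B] that by (auto simp: perp_def)
  have "\<xi> \<bullet> \<xi> = 1" using \<open>norm \<xi> = 1\<close> by (simp add: dot_square_norm)
  then show "\<xi> \<notin> B" using perp by auto
  have "x \<in> span (insert \<xi> B)" for x
  proof -
    have "x - (x \<bullet> \<xi>) *\<^sub>R \<xi> \<in> span B"
      unfolding B'(3) using \<open>\<xi> \<bullet> \<xi> = 1\<close> by (simp add: perp_def inner_diff_left)
    then show ?thesis by (auto simp: span_insert)
  qed
  then show *: "orthonormal_basis_of UNIV (insert \<xi> B)"
    using B' perp \<open>norm \<xi> = 1\<close>
    by (auto simp: orthonormal_basis_of_def pairwise_insert orthogonal_def inner_commute)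
  show "Suc (card B) = DIM('a)"
    using orthonormal_basis_of_facts(1,2)[OF *] \<open>\<xi> \<notin> B\<close> by simp
qed

text \<open>Adjoining the unit normal to an orthonormal basis of the hyperplane gives one of the
  whole space; Fubini's theorem in these coordinates singles out the normal coordinate s.\<close>

lemma nn_integral_slices:
  fixes \<xi> :: "'a::euclidean_space" and f :: "'a \<Rightarrow> ennreal"
  assumes B: "orthonormal_basis_of (perp \<xi>) B" and \<xi>: "norm \<xi> = 1" and [measurable]: "f \<in> borel_measurable borel"
  shows "(\<integral>\<^sup>+x. f x \<partial>lborel) = (\<integral>\<^sup>+s. (\<integral>\<^sup>+c. f ((\<Sum>b\<in>B. c b *\<^sub>R b) + s *\<^sub>R \<xi>) \<partial>(\<Pi>\<^sub>M b\<in>B. lborel)) \<partial>lborel)"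
proof -
  interpret product_sigma_finite "\<lambda>_. lborel :: real measure" by standard
  note I = orthonormal_basis_insert_perp[OF B \<xi>]
  have fin: "finite B" using orthonormal_basis_of_facts(1)[OF B] .
  have "(\<integral>\<^sup>+x. f x \<partial>lborel) = (\<integral>\<^sup>+c. f (\<Sum>b\<in>insert \<xi> B. c b *\<^sub>R b) \<partial>(\<Pi>\<^sub>M b\<in>insert \<xi> B. lborel))"
    by (rule nn_integral_orthonormal_basis[OF I(1), symmetric]) simp
  also have "\<dots> = (\<integral>\<^sup>+s. (\<integral>\<^sup>+c. f (\<Sum>b\<in>insert \<xi> B. (c(\<xi> := s)) b *\<^sub>R b) \<partial>(\<Pi>\<^sub>M b\<in>B. lborel)) \<partial>lborel)"
    by (rule product_nn_integral_insert_rev[OF fin I(2)]) measurable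
  also have "\<dots> = (\<integral>\<^sup>+s. (\<integral>\<^sup>+c. f ((\<Sum>b\<in>B. c b *\<^sub>R b) + s *\<^sub>R \<xi>) \<partial>(\<Pi>\<^sub>M b\<in>B. lborel)) \<partial>lborel)"
  proof -
    have "(\<Sum>b\<in>insert \<xi> B. (c(\<xi> := s)) b *\<^sub>R b) = (\<Sum>b\<in>B. c b *\<^sub>R b) + s *\<^sub>R \<xi>" for c s
      using fin I(2) by (subst sum.insert) (auto intro!: sum.cong simp: add.commute)
    then show ?thesis by (simp only:)
  qed
  finally show ?thesis .
qed

section \<open>Parallel sections of a star body\<close>

text \<open>\<open>R\<close> is a radius enclosing the unit body: by homogeneity,
  \<open>norm_le\<close> is boundedness of {N \<le> 1} in scale-free form, and it also forces N to
  be positive off the origin. The absolute value in \<open>hom\<close> carries the symmetry of the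
  body.\<close>

locale homogeneous_gauge =
  fixes N :: "'a::euclidean_space \<Rightarrow> real" and R :: real
  assumes cont: "continuous_on UNIV N"
    and hom: "N (c *\<^sub>R x) = \<bar>c\<bar> * N x"
    and norm_le: "norm x \<le> R * N x"
    and R_pos: "R > 0"
    and dim: "DIM('a) > 1"
begin

lemma borel_N[measurable]: "N \<in> borel_measurable borel"
  using cont by (rule borel_measurable_continuous_onI)

lemma N_nonneg: "N x \<ge> 0"
  using norm_le[of x] R_pos norm_ge_zero[of x] by (smt (verit) zero_le_mult_iff)

lemma N_pos: "x \<noteq> 0 \<Longrightarrow> N x > 0"
  using norm_le[of x] R_pos N_nonneg[of x] by (cases "N x = 0") auto

abbreviation unit_body :: "'a set" where
  "unit_body \<equiv> {x. N x \<le> 1}"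

lemma norm_le_unit_body: "x \<in> unit_body \<Longrightarrow> norm x \<le> R"
proof -
  assume "x \<in> unit_body"
  then have "R * N x \<le> R * 1" using R_pos by (intro mult_left_mono) auto
  with norm_le[of x] show "norm x \<le> R" by simp
qed

lemma emeasure_unit_body: "emeasure lborel unit_body < \<infinity>"
proof -
  have "emeasure lborel unit_body \<le> emeasure lborel (cball (0::'a) R)"
    using norm_le_unit_body by (intro emeasure_mono) auto
  also have "\<dots> < \<infinity>" using emeasure_lborel_cball_finite[of "0::'a" R] by simp
  finally show ?thesis .
qed

lemma integrable_unit_body: "integrable lborel (indicator unit_body :: 'a \<Rightarrow> real)"
  using emeasure_unit_body by (intro integrable_real_indicator) auto

text \<open>The level r varies because slices off the centre will be compared with central slices of
  slightly larger and smaller dilates.\<close>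

definition slice_volume :: "'a set \<Rightarrow> 'a \<Rightarrow> real \<Rightarrow> real" where
  "slice_volume B v r = measure (\<Pi>\<^sub>M b\<in>B. lborel)
     {c \<in> space (\<Pi>\<^sub>M b\<in>B. lborel). N ((\<Sum>b\<in>B. c b *\<^sub>R b) + v) \<le> r}"

lemma norm_slice:
  assumes B: "orthonormal_basis_of (perp \<xi>) B"
  shows "(norm ((\<Sum>b\<in>B. c b *\<^sub>R b) + s *\<^sub>R \<xi>))\<^sup>2 = (\<Sum>b\<in>B. (c b)\<^sup>2) + (s * norm \<xi>)\<^sup>2"
    and "((\<Sum>b\<in>B. c b *\<^sub>R b) + s *\<^sub>R \<xi>) \<bullet> \<xi> = s * (norm \<xi>)\<^sup>2"
proof -
  have *: "(\<Sum>b\<in>B. c b *\<^sub>R b) \<bullet> \<xi> = 0"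
    using orthonormal_basis_of_facts(3)[OF B] by (auto simp: inner_sum_left perp_def intro!: sum.neutral)
  then show "((\<Sum>b\<in>B. c b *\<^sub>R b) + s *\<^sub>R \<xi>) \<bullet> \<xi> = s * (norm \<xi>)\<^sup>2"
    by (simp add: inner_add_left power2_norm_eq_inner)
  have "orthogonal (\<Sum>b\<in>B. c b *\<^sub>R b) (s *\<^sub>R \<xi>)"
    using * by (simp add: orthogonal_def)
  from norm_add_Pythagorean[OF this]
  show "(norm ((\<Sum>b\<in>B. c b *\<^sub>R b) + s *\<^sub>R \<xi>))\<^sup>2 = (\<Sum>b\<in>B. (c b)\<^sup>2) + (s * norm \<xi>)\<^sup>2"
    by (simp add: orthonormal_basis_of_facts(4)[OF B] power_mult_distrib)
qed

text \<open>The slice lies in a coordinate cube of side 2 R r. This gives finiteness, so that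
  \<open>measure\<close> loses nothing, and the constant (2 R)^(n-1) that dominates all sections
  below.\<close>

lemma emeasure_slice_le:
  assumes B: "orthonormal_basis_of (perp \<xi>) B" and "r \<ge> 0"
  shows "emeasure (\<Pi>\<^sub>M b\<in>B. lborel) {c \<in> space (\<Pi>\<^sub>M b\<in>B. lborel). N ((\<Sum>b\<in>B. c b *\<^sub>R b) + s *\<^sub>R \<xi>) \<le> r}
    \<le> ennreal ((2 * (R * r)) ^ card B)"
proof -
  interpret product_sigma_finite "\<lambda>_. lborel :: real measure" by standard
  have fin: "finite B" using orthonormal_basis_of_facts(1)[OF B] .
  have "{c \<in> space (\<Pi>\<^sub>M b\<in>B. lborel). N ((\<Sum>b\<in>B. c b *\<^sub>R b) + s *\<^sub>R \<xi>) \<le> r} \<subseteq> Pi\<^sub>E B (\<lambda>_. {- (R * r)..R * r})"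
  proof (rule subsetI)
    fix c assume "c \<in> {c \<in> space (\<Pi>\<^sub>M b\<in>B. (lborel :: real measure)). N ((\<Sum>b\<in>B. c b *\<^sub>R b) + s *\<^sub>R \<xi>) \<le> r}"
    then have c: "c \<in> space (\<Pi>\<^sub>M b\<in>B. (lborel :: real measure))" "N ((\<Sum>b\<in>B. c b *\<^sub>R b) + s *\<^sub>R \<xi>) \<le> r"
      by auto
    have "R * N ((\<Sum>b\<in>B. c b *\<^sub>R b) + s *\<^sub>R \<xi>) \<le> R * r" using c(2) R_pos by (intro mult_left_mono) auto
    then have "norm ((\<Sum>b\<in>B. c b *\<^sub>R b) + s *\<^sub>R \<xi>) \<le> R * r"
      using norm_le[of "(\<Sum>b\<in>B. c b *\<^sub>R b) + s *\<^sub>R \<xi>"] by linarith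
    then have *: "(\<Sum>b\<in>B. (c b)\<^sup>2) + (s * norm \<xi>)\<^sup>2 \<le> (R * r)\<^sup>2"
      unfolding norm_slice(1)[OF B, symmetric] by (intro power_mono) auto
    have "\<bar>c b\<bar> \<le> R * r" if "b \<in> B" for b
    proof -
      have "(c b)\<^sup>2 \<le> (\<Sum>b\<in>B. (c b)\<^sup>2)" using that fin by (intro member_le_sum) auto
      also have "\<dots> \<le> (R * r)\<^sup>2" using * zero_le_power2[of "s * norm \<xi>"] by linarith
      finally show ?thesis using abs_le_square_iff[of "c b" "R * r"] R_pos \<open>r \<ge> 0\<close> by simp
    qed
    then show "c \<in> Pi\<^sub>E B (\<lambda>_. {- (R * r)..R * r})"
      using c(1) by (auto simp: space_PiM PiE_iff abs_le_iff) (smt (verit))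
  qed
  then have "emeasure (\<Pi>\<^sub>M b\<in>B. lborel) {c \<in> space (\<Pi>\<^sub>M b\<in>B. lborel). N ((\<Sum>b\<in>B. c b *\<^sub>R b) + s *\<^sub>R \<xi>) \<le> r}
     \<le> emeasure (\<Pi>\<^sub>M b\<in>B. lborel) (Pi\<^sub>E B (\<lambda>_. {- (R * r)..R * r}))"
    using fin by (intro emeasure_mono sets_PiM_I_finite) auto
  also have "\<dots> = (\<Prod>b\<in>B. emeasure lborel {- (R * r)..R * r})"
    using fin by (intro emeasure_PiM) auto
  also have "\<dots> = ennreal ((2 * (R * r)) ^ card B)"
    using R_pos \<open>r \<ge> 0\<close> by (simp add: ennreal_power)
  finally show ?thesis .
qed

lemma emeasure_slice:
  assumes B: "orthonormal_basis_of (perp \<xi>) B" and "r \<ge> 0"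
  shows "emeasure (\<Pi>\<^sub>M b\<in>B. lborel) {c \<in> space (\<Pi>\<^sub>M b\<in>B. lborel). N ((\<Sum>b\<in>B. c b *\<^sub>R b) + s *\<^sub>R \<xi>) \<le> r}
    = ennreal (slice_volume B (s *\<^sub>R \<xi>) r)"
  unfolding slice_volume_def using emeasure_slice_le[OF assms, of s]
  by (intro emeasure_eq_ennreal_measure) (auto simp: top_unique)

lemma slice_volume_bounds:
  assumes B: "orthonormal_basis_of (perp \<xi>) B" and "r \<ge> 0"
  shows "0 \<le> slice_volume B (s *\<^sub>R \<xi>) r" "slice_volume B (s *\<^sub>R \<xi>) r \<le> (2 * (R * r)) ^ card B"
  using emeasure_slice_le[OF assms, of s] R_pos \<open>r \<ge> 0\<close>
  by (auto simp: emeasure_slice[OF assms]) (simp add: slice_volume_def)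

text \<open>Dilation by r maps the central hyperplane to itself, so it acts on the coordinates of
  the central slice alone.\<close>

lemma slice_volume_scale:
  assumes B: "orthonormal_basis_of (perp \<xi>) B" and "r > 0"
  shows "slice_volume B 0 r = r ^ card B * slice_volume B 0 1"
proof -
  let ?P = "\<Pi>\<^sub>M b\<in>B. (lborel :: real measure)"
  have fin: "finite B" using orthonormal_basis_of_facts(1)[OF B] .
  have V: "ennreal (slice_volume B 0 q) = (\<integral>\<^sup>+c. indicator {..q} (N (\<Sum>b\<in>B. c b *\<^sub>R b)) \<partial>?P)" if "q > 0" for q
  proof -
    have "ennreal (slice_volume B 0 q) = (\<integral>\<^sup>+c. indicator {c \<in> space ?P. N ((\<Sum>b\<in>B. c b *\<^sub>R b) + 0 *\<^sub>R \<xi>) \<le> q} c \<partial>?P)"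
      using emeasure_slice[OF B, of q 0] that by simp
    also have "\<dots> = (\<integral>\<^sup>+c. indicator {..q} (N (\<Sum>b\<in>B. c b *\<^sub>R b)) \<partial>?P)"
      by (intro nn_integral_cong) (auto simp: indicator_def)
    finally show ?thesis .
  qed
  have "ennreal (slice_volume B 0 r) = ennreal (\<bar>r\<bar> ^ card B) *
      (\<integral>\<^sup>+c. indicator {..r} (N (\<Sum>b\<in>B. (\<lambda>b\<in>B. 0 + r * c b) b *\<^sub>R b)) \<partial>?P)"
    unfolding V[OF \<open>r > 0\<close>] using \<open>r > 0\<close> fin by (intro nn_integral_PiM_lborel_affine) auto
  also have "(\<lambda>c. indicator {..r} (N (\<Sum>b\<in>B. (\<lambda>b\<in>B. 0 + r * c b) b *\<^sub>R b)))
      = (\<lambda>c. indicator {..1} (N (\<Sum>b\<in>B. c b *\<^sub>R b)) :: ennreal)"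
  proof
    fix c
    have "(\<Sum>b\<in>B. (\<lambda>b\<in>B. 0 + r * c b) b *\<^sub>R b) = r *\<^sub>R (\<Sum>b\<in>B. c b *\<^sub>R b)"
      by (simp add: scaleR_sum_right)
    then show "indicator {..r} (N (\<Sum>b\<in>B. (\<lambda>b\<in>B. 0 + r * c b) b *\<^sub>R b)) = (indicator {..1} (N (\<Sum>b\<in>B. c b *\<^sub>R b)) :: ennreal)"
      using \<open>r > 0\<close> by (auto simp: hom indicator_def mult_le_cancel_left1)
  qed
  also have "(\<integral>\<^sup>+c. indicator {..1} (N (\<Sum>b\<in>B. c b *\<^sub>R b)) \<partial>?P) = ennreal (slice_volume B 0 1)"
    by (rule V[symmetric]) simp
  finally have "ennreal (slice_volume B 0 r) = ennreal (r ^ card B * slice_volume B 0 1)"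
    using \<open>r > 0\<close> by (simp add: ennreal_mult')
  then show ?thesis
    using slice_volume_bounds(1)[OF B, of _ 0] \<open>r > 0\<close> by simp
qed

lemma slice_volume_mono:
  assumes B: "orthonormal_basis_of (perp \<xi>) B" and "r' \<ge> 0"
    and "\<And>x. N (x + s *\<^sub>R \<xi>) \<le> r \<Longrightarrow> N (x + s' *\<^sub>R \<xi>) \<le> r'"
  shows "slice_volume B (s *\<^sub>R \<xi>) r \<le> slice_volume B (s' *\<^sub>R \<xi>) r'"
  unfolding slice_volume_def
  using assms emeasure_slice_le[OF B \<open>r' \<ge> 0\<close>, of s']
  by (intro measure_mono_fmeasurable) (auto simp: fmeasurable_def less_top[symmetric] top_unique)

text \<open>Uniform continuity of \<open>N\<close> on bounded sets squeezes a nearby parallel slice between two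
  dilates of the central one. The estimate is uniform in \<open>\<xi>\<close>, which later gives continuity of
  the central section volume in the direction.\<close>

lemma slice_volume_near_0:
  assumes "\<delta> > 0"
  obtains \<eta> where "\<eta> > 0"
    "\<And>\<xi> B s. norm \<xi> = 1 \<Longrightarrow> orthonormal_basis_of (perp \<xi>) B \<Longrightarrow> \<bar>s\<bar> \<le> \<eta> \<Longrightarrow>
      \<bar>slice_volume B (s *\<^sub>R \<xi>) 1 - slice_volume B 0 1\<bar> \<le> \<delta>"
proof -
  define m where "m = DIM('a) - 1"
  \<comment> \<open>An upper bound for every central slice volume, whatever the direction.\<close>
  define C where "C = (2 * R) ^ m"
  have C: "C > 0" using R_pos by (simp add: C_def)
  have "((\<lambda>\<theta>. C * ((1 + \<theta>) ^ m - 1)) \<longlongrightarrow> C * ((1 + 0) ^ m - 1)) (at_right 0)"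
    by (intro tendsto_intros)
  moreover have "((\<lambda>\<theta>. C * (1 - (1 - \<theta>) ^ m)) \<longlongrightarrow> C * (1 - (1 - 0) ^ m)) (at_right 0)"
    by (intro tendsto_intros)
  \<comment> \<open>\<theta> is so small that dilating a central slice by 1 + \<theta> or 1 -
    \<theta> changes its volume by less than \<delta>.\<close>
  ultimately have "\<forall>\<^sub>F \<theta> in at_right 0. C * ((1 + \<theta>) ^ m - 1) < \<delta> \<and> C * (1 - (1 - \<theta>) ^ m) < \<delta> \<and> 0 < \<theta> \<and> \<theta> < 1"
    using \<open>\<delta> > 0\<close> eventually_at_right_less[of "0::real"] eventually_at_right_real[of 0 "1::real"]
    by (auto intro!: eventually_conj order_tendstoD(2) elim: eventually_mono)
  then obtain \<theta> where \<theta>: "C * ((1 + \<theta>) ^ m - 1) < \<delta>" "C * (1 - (1 - \<theta>) ^ m) < \<delta>" "0 < \<theta>" "\<theta> < 1"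
    using eventually_happens[of _ "at_right (0::real)"] by (auto simp: trivial_limit_at_right_real)
  \<comment> \<open>R bounds the body, one unit is for undoing a shift out of it, and one more for
    performing a shift of length at most 1.\<close>
  have "uniformly_continuous_on (cball 0 (R + 2)) N"
    by (intro compact_uniformly_continuous continuous_on_subset[OF cont]) auto
  then obtain d where d: "d > 0"
    "\<And>x y. norm x \<le> R + 2 \<Longrightarrow> norm y \<le> R + 2 \<Longrightarrow> dist y x < d \<Longrightarrow> \<bar>N y - N x\<bar> < \<theta>"
    using \<theta>(3) unfolding uniformly_continuous_on_def
    by (metis dist_real_def mem_cball_0)
  have near: "\<bar>N (x + s *\<^sub>R \<xi>) - N x\<bar> < \<theta>"
    if "norm \<xi> = 1" "\<bar>s\<bar> \<le> min 1 (d / 2)" "norm x \<le> R + 1" for x s and \<xi> :: 'a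
  proof (rule d)
    show "norm (x + s *\<^sub>R \<xi>) \<le> R + 2" using norm_triangle_ineq[of x "s *\<^sub>R \<xi>"] that by simp
  qed (use that d(1) in \<open>auto simp: dist_norm\<close>)
  show thesis
  \<comment> \<open>Shifts of at most d / 2 are strictly shorter than d, as uniform continuity
    demands.\<close>
  proof (rule that[of "min 1 (d / 2)"])
    show "min 1 (d / 2) > 0" using d(1) by simp
    fix \<xi> :: 'a and B s
    assume \<xi>: "norm \<xi> = 1" and B: "orthonormal_basis_of (perp \<xi>) B" and s: "\<bar>s\<bar> \<le> min 1 (d / 2)"
    have m: "card B = m" using orthonormal_basis_insert_perp(3)[OF B \<xi>] by (simp add: m_def)
    let ?V = "slice_volume B 0 1"
    have V: "0 \<le> ?V" "?V \<le> C" using slice_volume_bounds[OF B, of 1 0] by (auto simp: C_def m)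
    have "slice_volume B (s *\<^sub>R \<xi>) 1 \<le> slice_volume B (0 *\<^sub>R \<xi>) (1 + \<theta>)"
    proof (rule slice_volume_mono[OF B])
      fix x assume x: "N (x + s *\<^sub>R \<xi>) \<le> 1"
      then have "norm (x + s *\<^sub>R \<xi>) \<le> R" using norm_le_unit_body by auto
      then have "norm x \<le> R + 1"
        using norm_triangle_ineq4[of "x + s *\<^sub>R \<xi>" "s *\<^sub>R \<xi>"] \<xi> s by simp
      from near[OF \<xi> s this] x show "N (x + 0 *\<^sub>R \<xi>) \<le> 1 + \<theta>" by simp
    qed (use \<theta> in auto)
    also have "\<dots> = (1 + \<theta>) ^ m * ?V" using slice_volume_scale[OF B, of "1 + \<theta>"] \<theta> m by simp
    finally have "slice_volume B (s *\<^sub>R \<xi>) 1 - ?V \<le> ?V * ((1 + \<theta>) ^ m - 1)" by (simp add: algebra_simps)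
    also have "\<dots> \<le> C * ((1 + \<theta>) ^ m - 1)" using V \<theta> by (intro mult_right_mono) auto
    finally have 1: "slice_volume B (s *\<^sub>R \<xi>) 1 - ?V \<le> \<delta>" using \<theta> by simp
    have "(1 - \<theta>) ^ m * ?V = slice_volume B (0 *\<^sub>R \<xi>) (1 - \<theta>)"
      using slice_volume_scale[OF B, of "1 - \<theta>"] \<theta> m by simp
    also have "\<dots> \<le> slice_volume B (s *\<^sub>R \<xi>) 1"
    proof (rule slice_volume_mono[OF B])
      fix x assume x: "N (x + 0 *\<^sub>R \<xi>) \<le> 1 - \<theta>"
      then have "norm x \<le> R" using norm_le_unit_body \<theta> by auto
      then have "norm x \<le> R + 1" by simp
      from near[OF \<xi> s this] x show "N (x + s *\<^sub>R \<xi>) \<le> 1" by simp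
    qed simp
    finally have "?V - slice_volume B (s *\<^sub>R \<xi>) 1 \<le> ?V * (1 - (1 - \<theta>) ^ m)" by (simp add: algebra_simps)
    also have "\<dots> \<le> C * (1 - (1 - \<theta>) ^ m)" using V \<theta> by (intro mult_right_mono) (auto simp: power_le_one)
    finally have 2: "?V - slice_volume B (s *\<^sub>R \<xi>) 1 \<le> \<delta>" using \<theta> by simp
    from 1 2 show "\<bar>slice_volume B (s *\<^sub>R \<xi>) 1 - ?V\<bar> \<le> \<delta>" by simp
  qed
qed

text \<open>No basis of \<open>perp \<xi>\<close> enters, so continuity in \<xi> is dominated
  convergence with \<epsilon> fixed.\<close>

definition smoothed_section :: "real \<Rightarrow> 'a \<Rightarrow> real" where
  "smoothed_section \<epsilon> \<xi> = (\<integral>y. indicator unit_body y * normal_density 0 \<epsilon> (y \<bullet> \<xi>) \<partial>lborel)"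

text \<open>The normal density depends on the coordinate s along \<xi> only, so slicing turns the
  body integral into an average of parallel slice volumes. Their measurability in s comes from being
  inner integrals of a measurable function on a product.\<close>

lemma smoothed_section_slices:
  assumes B: "orthonormal_basis_of (perp \<xi>) B" and \<xi>: "norm \<xi> = 1" and "\<epsilon> > 0"
  shows "(\<lambda>s. slice_volume B (s *\<^sub>R \<xi>) 1) \<in> borel_measurable borel"
    and "integrable lborel (\<lambda>s. normal_density 0 \<epsilon> s * slice_volume B (s *\<^sub>R \<xi>) 1)"
    and "smoothed_section \<epsilon> \<xi> = (\<integral>s. normal_density 0 \<epsilon> s * slice_volume B (s *\<^sub>R \<xi>) 1 \<partial>lborel)"
proof -
  interpret product_sigma_finite "\<lambda>_. lborel :: real measure" by standard
  let ?P = "\<Pi>\<^sub>M b\<in>B. (lborel :: real measure)"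
  interpret P: sigma_finite_measure ?P using orthonormal_basis_of_facts(1)[OF B] by (rule sigma_finite)
  have V: "(\<integral>\<^sup>+c. indicator {..1} (N ((\<Sum>b\<in>B. c b *\<^sub>R b) + s *\<^sub>R \<xi>)) \<partial>?P) = ennreal (slice_volume B (s *\<^sub>R \<xi>) 1)" for s
  proof -
    have "(\<integral>\<^sup>+c. indicator {..1} (N ((\<Sum>b\<in>B. c b *\<^sub>R b) + s *\<^sub>R \<xi>)) \<partial>?P)
        = (\<integral>\<^sup>+c. indicator {c \<in> space ?P. N ((\<Sum>b\<in>B. c b *\<^sub>R b) + s *\<^sub>R \<xi>) \<le> 1} c \<partial>?P)"
      by (intro nn_integral_cong) (auto simp: indicator_def)
    also have "\<dots> = ennreal (slice_volume B (s *\<^sub>R \<xi>) 1)"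
      using emeasure_slice[OF B, of 1 s] by simp
    finally show ?thesis .
  qed
  have "(\<lambda>s. enn2real (\<integral>\<^sup>+c. indicator {..1} (N ((\<Sum>b\<in>B. c b *\<^sub>R b) + s *\<^sub>R \<xi>)) \<partial>?P)) \<in> borel_measurable borel"
    by measurable
  then show [measurable]: "(\<lambda>s. slice_volume B (s *\<^sub>R \<xi>) 1) \<in> borel_measurable borel"
    using slice_volume_bounds(1)[OF B, of 1] by (simp add: V)
  have nonneg: "0 \<le> normal_density 0 \<epsilon> s * slice_volume B (s *\<^sub>R \<xi>) 1" for s
    using slice_volume_bounds(1)[OF B, of 1] by simp
  show "integrable lborel (\<lambda>s. normal_density 0 \<epsilon> s * slice_volume B (s *\<^sub>R \<xi>) 1)"
  proof (rule Bochner_Integration.integrable_bound)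
    show "integrable lborel (\<lambda>s. normal_density 0 \<epsilon> s * (2 * R) ^ card B)"
      using \<open>\<epsilon> > 0\<close> by simp
    show "AE s in lborel. norm (normal_density 0 \<epsilon> s * slice_volume B (s *\<^sub>R \<xi>) 1) \<le> norm (normal_density 0 \<epsilon> s * (2 * R) ^ card B)"
      using slice_volume_bounds[OF B, of 1] R_pos
      by (intro AE_I2) (auto simp: abs_mult intro!: mult_left_mono)
  qed measurable
  have "smoothed_section \<epsilon> \<xi> = enn2real (\<integral>\<^sup>+y. ennreal (indicator {..1} (N y) * normal_density 0 \<epsilon> (y \<bullet> \<xi>)) \<partial>lborel)"
    unfolding smoothed_section_def
    by (subst integral_eq_nn_integral) (auto simp: indicator_def)
  also have "(\<integral>\<^sup>+y. ennreal (indicator {..1} (N y) * normal_density 0 \<epsilon> (y \<bullet> \<xi>)) \<partial>lborel) =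
     (\<integral>\<^sup>+s. (\<integral>\<^sup>+c. ennreal (indicator {..1} (N ((\<Sum>b\<in>B. c b *\<^sub>R b) + s *\<^sub>R \<xi>)) * normal_density 0 \<epsilon> s) \<partial>?P) \<partial>lborel)"
    using nn_integral_slices[OF B \<xi>, of "\<lambda>y. ennreal (indicator {..1} (N y) * normal_density 0 \<epsilon> (y \<bullet> \<xi>))"] \<xi>
    by (simp add: norm_slice(2)[OF B])
  also have "\<dots> = (\<integral>\<^sup>+s. ennreal (normal_density 0 \<epsilon> s * slice_volume B (s *\<^sub>R \<xi>) 1) \<partial>lborel)"
  proof (rule nn_integral_cong)
    fix s
    have "(\<integral>\<^sup>+c. ennreal (indicator {..1} (N ((\<Sum>b\<in>B. c b *\<^sub>R b) + s *\<^sub>R \<xi>)) * normal_density 0 \<epsilon> s) \<partial>?P)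
       = (\<integral>\<^sup>+c. ennreal (normal_density 0 \<epsilon> s) * indicator {..1} (N ((\<Sum>b\<in>B. c b *\<^sub>R b) + s *\<^sub>R \<xi>)) \<partial>?P)"
      by (intro nn_integral_cong) (auto simp: indicator_def)
    also have "\<dots> = ennreal (normal_density 0 \<epsilon> s) * ennreal (slice_volume B (s *\<^sub>R \<xi>) 1)"
      by (subst nn_integral_cmult) (auto simp: V)
    finally show "(\<integral>\<^sup>+c. ennreal (indicator {..1} (N ((\<Sum>b\<in>B. c b *\<^sub>R b) + s *\<^sub>R \<xi>)) * normal_density 0 \<epsilon> s) \<partial>?P)
       = ennreal (normal_density 0 \<epsilon> s * slice_volume B (s *\<^sub>R \<xi>) 1)"
      using slice_volume_bounds(1)[OF B, of 1] by (simp add: ennreal_mult)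
  qed
  also have "enn2real \<dots> = (\<integral>s. normal_density 0 \<epsilon> s * slice_volume B (s *\<^sub>R \<xi>) 1 \<partial>lborel)"
    using nonneg by (subst integral_eq_nn_integral) auto
  finally show "smoothed_section \<epsilon> \<xi> = (\<integral>s. normal_density 0 \<epsilon> s * slice_volume B (s *\<^sub>R \<xi>) 1 \<partial>lborel)" .
qed

text \<open>An average of slice volumes obeys the cube bound of each slice, independently of
  \<epsilon>; this is what later allows dominated convergence.\<close>

lemma smoothed_section_le:
  assumes \<xi>: "norm \<xi> = 1" and "\<epsilon> > 0"
  shows "0 \<le> smoothed_section \<epsilon> \<xi>" "smoothed_section \<epsilon> \<xi> \<le> (2 * R) ^ (DIM('a) - 1)"
proof -
  obtain B where B: "orthonormal_basis_of (perp \<xi>) B" using orthonormal_basis_of_perp_exists by blast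
  have m: "card B = DIM('a) - 1" using orthonormal_basis_insert_perp(3)[OF B \<xi>] by simp
  note S = smoothed_section_slices[OF B \<xi> \<open>\<epsilon> > 0\<close>]
  show "0 \<le> smoothed_section \<epsilon> \<xi>"
    unfolding smoothed_section_def by (intro Bochner_Integration.integral_nonneg) auto
  have "smoothed_section \<epsilon> \<xi> \<le> (\<integral>s. normal_density 0 \<epsilon> s * (2 * R) ^ card B \<partial>lborel)"
    unfolding S(3) using S(2) slice_volume_bounds[OF B, of 1] \<open>\<epsilon> > 0\<close>
    by (intro integral_mono) (auto intro!: mult_left_mono)
  then show "smoothed_section \<epsilon> \<xi> \<le> (2 * R) ^ (DIM('a) - 1)" using \<open>\<epsilon> > 0\<close> by (simp add: m)
qed

text \<open>Chebyshev's argument: for |s| \<le> \<eta> the slice is close to the central one, and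
  beyond \<eta> the crude deviation C is at most C s^2 / \<eta>^2, whose mean is controlled by the
  variance \<epsilon>^2. Neither estimate sees the direction.\<close>

lemma smoothed_section_uniform_limit:
  assumes "e > 0"
  obtains \<epsilon>0 where "\<epsilon>0 > 0"
    "\<And>\<xi> B \<epsilon>. norm \<xi> = 1 \<Longrightarrow> orthonormal_basis_of (perp \<xi>) B \<Longrightarrow> 0 < \<epsilon> \<Longrightarrow> \<epsilon> \<le> \<epsilon>0 \<Longrightarrow>
       \<bar>smoothed_section \<epsilon> \<xi> - slice_volume B 0 1\<bar> \<le> e"
proof -
  obtain \<eta> where \<eta>: "\<eta> > 0"
    "\<And>\<xi> B s. norm \<xi> = 1 \<Longrightarrow> orthonormal_basis_of (perp \<xi>) B \<Longrightarrow> \<bar>s\<bar> \<le> \<eta> \<Longrightarrow>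
      \<bar>slice_volume B (s *\<^sub>R \<xi>) 1 - slice_volume B 0 1\<bar> \<le> e / 2"
    using slice_volume_near_0[of "e / 2"] \<open>e > 0\<close> by auto
  define C where "C = (2 * R) ^ (DIM('a) - 1)"
  have C: "C > 0" using R_pos by (simp add: C_def)
  \<comment> \<open>Chosen so that C \<epsilon>0^2 / \<eta>^2 = e / 2.\<close>
  define \<epsilon>0 where "\<epsilon>0 = \<eta> * sqrt (e / (2 * C))"
  show thesis
  proof (rule that[of \<epsilon>0])
    show "\<epsilon>0 > 0" using \<eta>(1) \<open>e > 0\<close> C by (simp add: \<epsilon>0_def)
    fix \<xi> :: 'a and B \<epsilon>
    assume \<xi>: "norm \<xi> = 1" and B: "orthonormal_basis_of (perp \<xi>) B" and \<epsilon>: "0 < \<epsilon>" "\<epsilon> \<le> \<epsilon>0"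
    have m: "card B = DIM('a) - 1" using orthonormal_basis_insert_perp(3)[OF B \<xi>] by simp
    note S = smoothed_section_slices[OF B \<xi> \<epsilon>(1)]
    note [measurable] = S(1)
    let ?n = "normal_density 0 \<epsilon>" and ?V = "\<lambda>s. slice_volume B (s *\<^sub>R \<xi>) 1"
    have bd: "\<bar>?V s - ?V 0\<bar> \<le> e / 2 + C / \<eta>\<^sup>2 * s\<^sup>2" for s
    proof (cases "\<bar>s\<bar> \<le> \<eta>")
      case True
      have "0 \<le> C / \<eta>\<^sup>2 * s\<^sup>2" using C by simp
      with \<eta>(2)[OF \<xi> B True] show ?thesis by simp
    next
      case False
      have "\<bar>?V s - ?V 0\<bar> \<le> C"
        using slice_volume_bounds[OF B, of 1 s] slice_volume_bounds[OF B, of 1 0] by (auto simp: C_def m)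
      also have "C = C / \<eta>\<^sup>2 * \<eta>\<^sup>2" using \<eta>(1) by simp
      also have "\<dots> \<le> C / \<eta>\<^sup>2 * s\<^sup>2"
        using False C \<eta>(1) by (intro mult_left_mono) (auto simp: abs_le_square_iff[symmetric])
      finally show ?thesis using \<open>e > 0\<close> by simp
    qed
    have m2: "has_bochner_integral lborel (\<lambda>s. ?n s * s\<^sup>2) (\<epsilon>\<^sup>2)"
      using normal_moment_even[OF \<epsilon>(1), of 0 1] by (simp add: fact_numeral)
    have m0: "has_bochner_integral lborel ?n 1"
      using \<epsilon>(1) by (simp add: has_bochner_integral_iff)
    have I: "has_bochner_integral lborel (\<lambda>s. e / 2 * ?n s + C / \<eta>\<^sup>2 * (?n s * s\<^sup>2)) (e / 2 * 1 + C / \<eta>\<^sup>2 * \<epsilon>\<^sup>2)"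
      by (intro has_bochner_integral_add has_bochner_integral_mult_right m0 m2)
    have eq: "smoothed_section \<epsilon> \<xi> - ?V 0 = (\<integral>s. ?n s * ?V s - ?n s * ?V 0 \<partial>lborel)"
      using S(2) \<epsilon>(1) by (subst Bochner_Integration.integral_diff) (auto simp: S(3))
    have "\<bar>smoothed_section \<epsilon> \<xi> - ?V 0\<bar> \<le> (\<integral>s. \<bar>?n s * ?V s - ?n s * ?V 0\<bar> \<partial>lborel)"
      unfolding eq by (rule integral_abs_bound)
    also have "\<dots> \<le> (\<integral>s. e / 2 * ?n s + C / \<eta>\<^sup>2 * (?n s * s\<^sup>2) \<partial>lborel)"
    proof (rule integral_mono)
      show "integrable lborel (\<lambda>s. \<bar>?n s * ?V s - ?n s * ?V 0\<bar>)"
        using S(2) \<epsilon>(1) by (intro integrable_abs Bochner_Integration.integrable_diff) auto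
      show "integrable lborel (\<lambda>s. e / 2 * ?n s + C / \<eta>\<^sup>2 * (?n s * s\<^sup>2))"
        using I by (simp add: has_bochner_integral_iff)
      fix s
      have "\<bar>?n s * ?V s - ?n s * ?V 0\<bar> = ?n s * \<bar>?V s - ?V 0\<bar>"
        by (simp add: abs_mult flip: right_diff_distrib)
      also have "\<dots> \<le> ?n s * (e / 2 + C / \<eta>\<^sup>2 * s\<^sup>2)" by (intro mult_left_mono bd) simp
      finally show "\<bar>?n s * ?V s - ?n s * ?V 0\<bar> \<le> e / 2 * ?n s + C / \<eta>\<^sup>2 * (?n s * s\<^sup>2)"
        by (simp add: algebra_simps)
    qed
    also have "\<dots> = e / 2 * 1 + C / \<eta>\<^sup>2 * \<epsilon>\<^sup>2" using I by (rule has_bochner_integral_integral_eq)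
    also have "\<dots> \<le> e / 2 + C / \<eta>\<^sup>2 * \<epsilon>0\<^sup>2"
      using \<epsilon> C by (auto intro!: mult_left_mono divide_right_mono power_mono)
    also have "\<dots> = e"
      using \<eta>(1) C \<open>e > 0\<close> by (simp add: \<epsilon>0_def power_mult_distrib)
    finally show "\<bar>smoothed_section \<epsilon> \<xi> - slice_volume B 0 1\<bar> \<le> e" by simp
  qed
qed

text \<open>The product of y and \<xi> is |\<xi>| times that of y and \<open>sgn \<xi>\<close>, and
  a normal density absorbs a factor in its argument into its deviation. This carries the estimates
  on the sphere to all nonzero \<xi>, and makes the limit homogeneous of degree -1.\<close>

lemma smoothed_section_rescale:
  assumes "\<xi> \<noteq> 0" "\<epsilon> > 0"
  shows "smoothed_section \<epsilon> \<xi> = inverse (norm \<xi>) * smoothed_section (\<epsilon> / norm \<xi>) (sgn \<xi>)"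
proof -
  have "normal_density 0 \<epsilon> (y \<bullet> \<xi>) = inverse (norm \<xi>) * normal_density 0 (\<epsilon> / norm \<xi>) (y \<bullet> sgn \<xi>)" for y
    using assms
    by (simp add: normal_density_def sgn_div_norm power_divide real_sqrt_mult real_sqrt_divide field_simps)
  then show ?thesis
    unfolding smoothed_section_def by (simp add: mult.left_commute[of _ "inverse (norm \<xi>)"])
qed

lemma continuous_on_smoothed_section:
  assumes "\<epsilon> > 0"
  shows "continuous_on UNIV (smoothed_section \<epsilon>)"
proof (rule continuous_on_sequentiallyI)
  fix u :: "nat \<Rightarrow> 'a" and a assume u: "u \<longlonglongrightarrow> a"
  have nd: "normal_density 0 \<epsilon> s \<le> 1 / sqrt (2 * pi * \<epsilon>\<^sup>2)" for s
    using \<open>\<epsilon> > 0\<close> by (simp add: normal_density_def divide_right_mono)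
  show "(\<lambda>n. smoothed_section \<epsilon> (u n)) \<longlonglongrightarrow> smoothed_section \<epsilon> a"
    unfolding smoothed_section_def
  proof (rule integral_dominated_convergence[where w = "\<lambda>y. indicator unit_body y * (1 / sqrt (2 * pi * \<epsilon>\<^sup>2))"])
    show "integrable lborel (\<lambda>y::'a. indicator unit_body y * (1 / sqrt (2 * pi * \<epsilon>\<^sup>2)) :: real)"
      using integrable_unit_body by (rule integrable_mult_left)
    show "AE y in lborel. (\<lambda>n. indicator unit_body y * normal_density 0 \<epsilon> (y \<bullet> u n)) \<longlonglongrightarrow> indicator unit_body y * normal_density 0 \<epsilon> (y \<bullet> a)"
      unfolding normal_density_def using \<open>\<epsilon> > 0\<close> by (intro AE_I2 tendsto_intros u) auto
    show "AE y in lborel. norm (indicator unit_body y * normal_density 0 \<epsilon> (y \<bullet> u n)) \<le> indicator unit_body y * (1 / sqrt (2 * pi * \<epsilon>\<^sup>2))" for n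
      using nd by (intro AE_I2) (auto simp: indicator_def)
  qed measurable
qed

text \<open>The extension of the central section volume from the sphere, homogeneous of degree -1.
  Its value at the origin is 0 because \<open>inverse 0 = 0\<close>.\<close>

definition section_function :: "'a \<Rightarrow> real" where
  "section_function \<xi> = inverse (norm \<xi>) * measure (subspace_lborel (perp (sgn \<xi>))) (unit_body \<inter> perp (sgn \<xi>))"

text \<open>Exposes the basis behind the choice in \<open>subspace_lborel\<close>. The slice
  estimates hold for every orthonormal basis, hence for this one.\<close>

lemma section_volume_slice:
  obtains B where "orthonormal_basis_of (perp \<xi>) B"
    "measure (subspace_lborel (perp \<xi>)) (unit_body \<inter> perp \<xi>) = slice_volume B 0 1"
proof -
  define B where "B = (SOME B. orthonormal_basis_of (perp \<xi>) B)"
  have B: "orthonormal_basis_of (perp \<xi>) B"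
    unfolding B_def using orthonormal_basis_of_perp_exists by (rule someI_ex)
  let ?P = "\<Pi>\<^sub>M b\<in>B. (lborel :: real measure)" and ?\<Phi> = "\<lambda>c. \<Sum>b\<in>B. c b *\<^sub>R b"
  have "closed (perp \<xi>)" by (rule closed_subspace[OF subspace_perp])
  then have [measurable]: "unit_body \<inter> perp \<xi> \<in> sets borel" by measurable
  have "measure (subspace_lborel (perp \<xi>)) (unit_body \<inter> perp \<xi>) = measure ?P (?\<Phi> -` (unit_body \<inter> perp \<xi>) \<inter> space ?P)"
    unfolding subspace_lborel_def Let_def B_def[symmetric] by (intro measure_distr) auto
  also have "?\<Phi> -` (unit_body \<inter> perp \<xi>) \<inter> space ?P = {c \<in> space ?P. N (?\<Phi> c + 0) \<le> 1}"
  proof -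
    have "?\<Phi> c \<in> perp \<xi>" for c
      using orthonormal_basis_of_facts(3)[OF B]
      by (intro subspace_sum subspace_scale subspace_perp) auto
    then show ?thesis by auto
  qed
  finally show thesis by (intro that[OF B]) (simp add: slice_volume_def)
qed

lemma section_function_bounds:
  assumes "\<xi> \<noteq> 0"
  shows "0 \<le> section_function \<xi>" "section_function \<xi> \<le> (2 * R) ^ (DIM('a) - 1) * inverse (norm \<xi>)"
proof -
  have s: "norm (sgn \<xi>) = 1" using assms by (simp add: norm_sgn)
  obtain B where B: "orthonormal_basis_of (perp (sgn \<xi>)) B"
    "measure (subspace_lborel (perp (sgn \<xi>))) (unit_body \<inter> perp (sgn \<xi>)) = slice_volume B 0 1"
    by (rule section_volume_slice)
  have m: "card B = DIM('a) - 1" using orthonormal_basis_insert_perp(3)[OF B(1) s] by simp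
  show "0 \<le> section_function \<xi>" "section_function \<xi> \<le> (2 * R) ^ (DIM('a) - 1) * inverse (norm \<xi>)"
    unfolding section_function_def B(2) using slice_volume_bounds[OF B(1), of 1 0]
    by (auto simp: m mult.commute intro: mult_left_mono)
qed

lemma smoothed_section_tendsto:
  assumes "\<xi> \<noteq> 0" and \<epsilon>: "\<epsilon> \<longlonglongrightarrow> 0" "\<And>n. \<epsilon> n > 0"
  shows "(\<lambda>n. smoothed_section (\<epsilon> n) \<xi>) \<longlonglongrightarrow> section_function \<xi>"
proof -
  have s: "norm (sgn \<xi>) = 1" using assms by (simp add: norm_sgn)
  obtain B where B: "orthonormal_basis_of (perp (sgn \<xi>)) B"
    "measure (subspace_lborel (perp (sgn \<xi>))) (unit_body \<inter> perp (sgn \<xi>)) = slice_volume B 0 1"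
    by (rule section_volume_slice)
  have "(\<lambda>n. smoothed_section (\<epsilon> n / norm \<xi>) (sgn \<xi>)) \<longlonglongrightarrow> slice_volume B 0 1"
  proof (rule LIMSEQ_I)
    fix e :: real assume "e > 0"
    then obtain \<epsilon>0 where \<epsilon>0: "\<epsilon>0 > 0"
      "\<And>\<epsilon>. 0 < \<epsilon> \<Longrightarrow> \<epsilon> \<le> \<epsilon>0 \<Longrightarrow> \<bar>smoothed_section \<epsilon> (sgn \<xi>) - slice_volume B 0 1\<bar> \<le> e / 2"
      using smoothed_section_uniform_limit[of "e / 2"] B(1) s
      by (metis half_gt_zero)
    have "(\<lambda>n. \<epsilon> n / norm \<xi>) \<longlonglongrightarrow> 0 / norm \<xi>" using \<epsilon>(1) assms(1) by (intro tendsto_intros) auto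
    then have "\<forall>\<^sub>F n in sequentially. \<epsilon> n / norm \<xi> < \<epsilon>0"
      using \<epsilon>0(1) by (intro order_tendstoD(2)) auto
    then obtain no where "\<And>n. n \<ge> no \<Longrightarrow> \<epsilon> n / norm \<xi> < \<epsilon>0" by (auto simp: eventually_sequentially)
    then have "\<And>n. n \<ge> no \<Longrightarrow> norm (smoothed_section (\<epsilon> n / norm \<xi>) (sgn \<xi>) - slice_volume B 0 1) < e"
      using \<epsilon>0(2)[of "\<epsilon> _ / norm \<xi>"] \<epsilon>(2) assms(1) \<open>e > 0\<close> by (smt (verit) divide_pos_pos field_sum_of_halves real_norm_def zero_less_norm_iff)
    then show "\<exists>no. \<forall>n\<ge>no. norm (smoothed_section (\<epsilon> n / norm \<xi>) (sgn \<xi>) - slice_volume B 0 1) < e" by blast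
  qed
  then have "(\<lambda>n. inverse (norm \<xi>) * smoothed_section (\<epsilon> n / norm \<xi>) (sgn \<xi>)) \<longlonglongrightarrow> inverse (norm \<xi>) * slice_volume B 0 1"
    by (intro tendsto_intros)
  then show ?thesis
    by (simp add: smoothed_section_rescale[OF assms(1) \<epsilon>(2)] section_function_def B(2))
qed

text \<open>On the sphere the section volume is a uniform limit of continuous smoothed sections;
  composing with \<open>sgn\<close>, which is continuous off the origin, extends this to all nonzero
  vectors.\<close>

lemma continuous_on_section_function: "continuous_on (- {0}) section_function"
proof -
  let ?V = "\<lambda>\<xi>. measure (subspace_lborel (perp \<xi>)) (unit_body \<inter> perp \<xi>)"
  have "continuous_on (sphere 0 1) ?V"
  proof (rule uniform_limit_theorem)
    show "\<forall>\<^sub>F \<epsilon> in at_right 0. continuous_on (sphere 0 1) (smoothed_section \<epsilon>)"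
      using eventually_at_right_less[of "0::real"]
      by eventually_elim (intro continuous_on_subset[OF continuous_on_smoothed_section], auto)
    show "uniform_limit (sphere 0 1) smoothed_section ?V (at_right 0)"
    proof (rule uniform_limitI)
      fix e :: real assume "e > 0"
      then obtain \<epsilon>0 where \<epsilon>0: "\<epsilon>0 > 0"
        "\<And>\<xi> B \<epsilon>. norm \<xi> = 1 \<Longrightarrow> orthonormal_basis_of (perp \<xi>) B \<Longrightarrow> 0 < \<epsilon> \<Longrightarrow> \<epsilon> \<le> \<epsilon>0 \<Longrightarrow>
           \<bar>smoothed_section \<epsilon> \<xi> - slice_volume B 0 1\<bar> \<le> e / 2"
        using smoothed_section_uniform_limit[of "e / 2"] by (metis half_gt_zero)
      have "dist (smoothed_section \<epsilon> \<xi>) (?V \<xi>) < e" if "0 < \<epsilon>" "\<epsilon> < \<epsilon>0" "norm \<xi> = 1" for \<epsilon> \<xi>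
      proof -
        obtain B where B: "orthonormal_basis_of (perp \<xi>) B" "?V \<xi> = slice_volume B 0 1"
          by (rule section_volume_slice)
        show ?thesis using \<epsilon>0(2)[OF that(3) B(1) that(1)] that(2) \<open>e > 0\<close> by (simp add: dist_real_def B(2))
      qed
      then show "\<forall>\<^sub>F \<epsilon> in at_right 0. \<forall>\<xi>\<in>sphere 0 1. dist (smoothed_section \<epsilon> \<xi>) (?V \<xi>) < e"
        using eventually_at_right_real[OF \<epsilon>0(1)] by (auto elim!: eventually_mono)
    qed
  qed (simp add: trivial_limit_at_right_real)
  then have "continuous_on (- {0}) (\<lambda>\<xi>. ?V (sgn \<xi>))"
    by (rule continuous_on_compose2) (auto intro!: continuous_intros simp: norm_sgn split: if_splits)
  then show ?thesis
    unfolding section_function_def[abs_def] by (intro continuous_intros) auto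
qed

end

section \<open>The Fourier transform of the gauge\<close>

text \<open>Integration by parts without boundary terms: F(x + b) - F(x) is the integral of D over
  the segment from x to x + b. Integrated over x, the difference vanishes by translation invariance,
  while Fubini's theorem turns the segment integrals into the full integral of D.\<close>

lemma integral_directional_derivative_eq_0:
  fixes F D :: "'a::euclidean_space \<Rightarrow> complex"
  assumes D: "\<And>x. ((\<lambda>s. F (x + s *\<^sub>R b)) has_vector_derivative D x) (at 0)"
    and F: "integrable lborel F" "integrable lborel D" "continuous_on UNIV D"
  shows "(\<integral>x. D x \<partial>lborel) = 0"
proof -
  have [measurable]: "D \<in> borel_measurable borel" "F \<in> borel_measurable borel"
    using F by (auto intro: borel_measurable_continuous_onI dest: borel_measurable_integrable)
  \<comment> \<open>The hypothesis at parameter 0 with base point x + s b is the derivative at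
    parameter s with base point x.\<close>
  have vd: "((\<lambda>s. F (x + s *\<^sub>R b)) has_vector_derivative D (x + s *\<^sub>R b)) (at s within T)" for x s T
  proof -
    have "((\<lambda>u. F ((x + s *\<^sub>R b) + u *\<^sub>R b)) \<circ> (\<lambda>u. u - s) has_vector_derivative 1 *\<^sub>R D (x + s *\<^sub>R b)) (at s)"
    proof (rule vector_diff_chain_at)
      show "((\<lambda>u. u - s) has_vector_derivative 1) (at s)"
        by (auto intro!: derivative_eq_intros)
      show "((\<lambda>u. F (x + s *\<^sub>R b + u *\<^sub>R b)) has_vector_derivative D (x + s *\<^sub>R b)) (at (s - s))"
        using D[of "x + s *\<^sub>R b"] by simp
    qed
    then have "((\<lambda>s. F (x + s *\<^sub>R b)) has_vector_derivative D (x + s *\<^sub>R b)) (at s)"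
      by (simp add: o_def algebra_simps)
    then show ?thesis by (rule has_vector_derivative_at_within)
  qed
  have ftc: "(\<integral>s. indicator {0..1} s *\<^sub>R D (x + s *\<^sub>R b) \<partial>lborel) = F (x + b) - F x" for x
    using integral_FTC_Icc[of 0 1 "\<lambda>s. F (x + s *\<^sub>R b)" "\<lambda>s. D (x + s *\<^sub>R b)"] vd
    by (simp add: continuous_on_compose2[OF F(3)] continuous_intros)
  have shift: "integrable lborel (\<lambda>x. h (x + v))" "(\<integral>x. h (x + v) \<partial>lborel) = (\<integral>x. h x \<partial>lborel)"
    if "integrable lborel h" and [measurable]: "h \<in> borel_measurable borel" for h :: "'a \<Rightarrow> complex" and v
    using integrable_lborel_affine_iff[of h 1 v] lborel_integral_affine[of h 1 v] that(1)
    by (simp_all add: add.commute)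
  have I: "integrable (lborel \<Otimes>\<^sub>M lborel) (\<lambda>(s, x). indicator {0..1::real} s *\<^sub>R D (x + s *\<^sub>R b))"
  proof (rule integrableI_bounded)
    have "(\<integral>\<^sup>+p. norm (case p of (s, x) \<Rightarrow> indicator {0..1::real} s *\<^sub>R D (x + s *\<^sub>R b)) \<partial>(lborel \<Otimes>\<^sub>M lborel))
       = (\<integral>\<^sup>+s. \<integral>\<^sup>+x. indicator {0..1::real} s * ennreal (norm (D (x + s *\<^sub>R b))) \<partial>lborel \<partial>lborel)"
      by (subst lborel.nn_integral_fst[symmetric])
         (auto simp: case_prod_unfold indicator_def intro!: nn_integral_cong)
    also have "\<dots> = (\<integral>\<^sup>+s. indicator {0..1::real} s * (\<integral>\<^sup>+x. ennreal (norm (D x)) \<partial>lborel) \<partial>lborel)"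
    proof (rule nn_integral_cong)
      fix s :: real
      have "(\<integral>\<^sup>+x. ennreal (norm (D (x + s *\<^sub>R b))) \<partial>lborel) = (\<integral>\<^sup>+x. ennreal (norm (D x)) \<partial>lborel)"
        using nn_integral_lborel_affine[of "\<lambda>x. ennreal (norm (D x))" 1 "s *\<^sub>R b"] by (simp add: add.commute)
      then show "(\<integral>\<^sup>+x. indicator {0..1} s * ennreal (norm (D (x + s *\<^sub>R b))) \<partial>lborel) =
          indicator {0..1} s * (\<integral>\<^sup>+x. ennreal (norm (D x)) \<partial>lborel)"
        by (simp add: nn_integral_cmult)
    qed
    also have "\<dots> = (\<integral>\<^sup>+x. ennreal (norm (D x)) \<partial>lborel)"
      by (subst nn_integral_multc) auto
    also have "\<dots> < \<infinity>" using F(2) by (simp add: integrable_iff_bounded)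
    finally show "(\<integral>\<^sup>+p. norm (case p of (s, x) \<Rightarrow> indicator {0..1::real} s *\<^sub>R D (x + s *\<^sub>R b)) \<partial>(lborel \<Otimes>\<^sub>M lborel)) < \<infinity>" .
  qed measurable
  have "0 = (\<integral>x. F (x + b) \<partial>lborel) - (\<integral>x. F x \<partial>lborel)" using shift[OF F(1)] by simp
  also have "\<dots> = (\<integral>x. F (x + b) - F x \<partial>lborel)"
    using shift[OF F(1)] F(1) by (subst Bochner_Integration.integral_diff) auto
  also have "\<dots> = (\<integral>x. (\<integral>s. indicator {0..1} s *\<^sub>R D (x + s *\<^sub>R b) \<partial>lborel) \<partial>lborel)" by (simp add: ftc)
  also have "\<dots> = (\<integral>s. (\<integral>x. indicator {0..1} s *\<^sub>R D (x + s *\<^sub>R b) \<partial>lborel) \<partial>lborel)"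
    using I by (rule lborel_pair.Fubini_integral)
  also have "\<dots> = (\<integral>s. indicator {0..1} s *\<^sub>R (\<integral>x. D x \<partial>lborel) \<partial>(lborel :: real measure))"
    using shift(2)[OF F(2)] by simp
  also have "\<dots> = (\<integral>x. D x \<partial>lborel)"
    by (subst integral_scaleR_left) auto
  finally show ?thesis ..
qed

section \<open>Decay of the Fourier transform of a Schwartz function\<close>

lemma norm_fourier_kernel [simp]: "norm (exp (- (\<i> * complex_of_real r))) = 1"
  by (simp add: norm_exp_eq_Re)

lemma integrable_fourier_kernel:
  assumes "integrable lborel \<phi>"
  shows "integrable lborel (\<lambda>x::'a::euclidean_space. \<phi> x * exp (- (\<i> * complex_of_real (x \<bullet> \<xi>))))"
proof (rule Bochner_Integration.integrable_bound[OF assms])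
  show "(\<lambda>x. \<phi> x * exp (- (\<i> * complex_of_real (x \<bullet> \<xi>)))) \<in> borel_measurable lborel"
    using borel_measurable_integrable[OF assms] by measurable
qed (simp add: norm_mult)

lemma norm_fourier_le: "norm (fourier \<phi> \<xi>) \<le> (\<integral>x. norm (\<phi> x) \<partial>lborel)"
  unfolding fourier_def using integral_norm_bound[of lborel "\<lambda>x. \<phi> x * exp (- (\<i> * complex_of_real (x \<bullet> \<xi>)))"]
  by (simp add: norm_mult)

lemma borel_measurable_fourier[measurable]:
  assumes [measurable]: "\<phi> \<in> borel_measurable borel"
  shows "fourier \<phi> \<in> borel_measurable borel"
  unfolding fourier_def[abs_def] by measurable

text \<open>The derivative along b of the product of \<open>iter_deriv vs \<phi>\<close> and the
  kernel has integral 0; the kernel contributes the factor -i times the product of b and \<xi>,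
  which changes sign on the other side.\<close>

lemma fourier_iter_deriv:
  fixes \<phi> :: "'a::euclidean_space \<Rightarrow> complex"
  assumes "DIM('a) > 1" "schwartz \<phi>" and b: "b \<in> Basis" and vs: "set vs \<subseteq> Basis"
  shows "fourier (iter_deriv (b # vs) \<phi>) \<xi> = \<i> * complex_of_real (b \<bullet> \<xi>) * fourier (iter_deriv vs \<phi>) \<xi>"
proof -
  let ?\<psi> = "iter_deriv vs \<phi>" and ?d = "iter_deriv (b # vs) \<phi>"
  let ?e = "\<lambda>x. exp (- (\<i> * complex_of_real (x \<bullet> \<xi>)))"
  let ?D = "\<lambda>x. ?d x * ?e x - \<i> * complex_of_real (b \<bullet> \<xi>) * (?\<psi> x * ?e x)"
  have vs': "set (b # vs) \<subseteq> Basis" using b vs by simp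
  note i = integrable_fourier_kernel[OF schwartz_integrable[OF assms(1,2)]]
  have "(\<integral>x. ?D x \<partial>lborel) = 0"
  proof (rule integral_directional_derivative_eq_0[where b = b])
    fix x
    have "(?\<psi> has_derivative frechet_derivative ?\<psi> (at x)) (at x)"
      using schwartz_iter_deriv(1)[OF assms(2) vs] by (simp add: frechet_derivative_works)
    then have "((\<lambda>s. ?\<psi> (x + s *\<^sub>R b)) has_derivative (\<lambda>s. frechet_derivative ?\<psi> (at x) (s *\<^sub>R b))) (at (0::real))"
      by (intro has_derivative_compose[where g = ?\<psi> and f = "\<lambda>s. x + s *\<^sub>R b"])
         (auto intro!: derivative_eq_intros)
    moreover have "linear (frechet_derivative ?\<psi> (at x))"
      using schwartz_iter_deriv(1)[OF assms(2) vs] by (intro linear_frechet_derivative)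
    ultimately have 1: "((\<lambda>s. ?\<psi> (x + s *\<^sub>R b)) has_vector_derivative ?d x) (at 0)"
      by (simp add: has_vector_derivative_def linear_cmul)
    have 2: "((\<lambda>s. ?e (x + s *\<^sub>R b)) has_vector_derivative - (\<i> * complex_of_real (b \<bullet> \<xi>)) * ?e x) (at 0)"
    proof -
      have "((\<lambda>z. exp (- (\<i> * (complex_of_real (x \<bullet> \<xi>) + z * complex_of_real (b \<bullet> \<xi>))))) has_field_derivative
          - (\<i> * complex_of_real (b \<bullet> \<xi>)) * ?e x) (at (complex_of_real 0))"
        by (auto intro!: derivative_eq_intros)
      from has_vector_derivative_real_field[OF this] show ?thesis by (simp add: inner_add_left)
    qed
    from has_vector_derivative_mult[OF 1 2]
    show "((\<lambda>s. ?\<psi> (x + s *\<^sub>R b) * ?e (x + s *\<^sub>R b)) has_vector_derivative ?D x) (at 0)"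
      by (simp add: algebra_simps)
  next
    show "integrable lborel (\<lambda>x. ?\<psi> x * ?e x)" by (rule i[OF vs])
    show "integrable lborel ?D"
      by (intro Bochner_Integration.integrable_diff Bochner_Integration.integrable_mult_right i vs vs')
    show "continuous_on UNIV ?D"
      using schwartz_iter_deriv(2)[OF assms(2) vs] schwartz_iter_deriv(2)[OF assms(2) vs']
      by (intro continuous_intros)
  qed
  also have "(\<integral>x. ?D x \<partial>lborel) = fourier ?d \<xi> - \<i> * complex_of_real (b \<bullet> \<xi>) * fourier ?\<psi> \<xi>"
    unfolding fourier_def using i[OF vs] i[OF vs']
    by (subst Bochner_Integration.integral_diff) (auto simp del: iter_deriv.simps)
  finally show ?thesis by simp
qed

text \<open>Two derivatives along each basis vector give a factor equal to the squared coordinate of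
  \<xi>; summing over the basis yields |\<xi>|^2. Quadratic decay is what the integrable
  \<open>weight\<close> asks for.\<close>

lemma fourier_schwartz_decay:
  fixes \<phi> :: "'a::euclidean_space \<Rightarrow> complex"
  assumes "DIM('a) > 1" "schwartz \<phi>"
  obtains C where "C \<ge> 0" "\<And>\<xi>. norm (fourier \<phi> \<xi>) \<le> C * inverse (1 + (norm \<xi>)\<^sup>2)"
proof -
  define I where "I vs = (\<integral>x. norm (iter_deriv vs \<phi> x) \<partial>lborel)" for vs
  have I0: "I vs \<ge> 0" for vs unfolding I_def by (intro Bochner_Integration.integral_nonneg) simp
  define C where "C = I [] + (\<Sum>b\<in>Basis. I [b, b])"
  have "norm (fourier \<phi> \<xi>) * (1 + (norm \<xi>)\<^sup>2) \<le> C" for \<xi>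
  proof -
    have b: "norm (fourier \<phi> \<xi>) * (b \<bullet> \<xi>)\<^sup>2 \<le> I [b, b]" if "b \<in> Basis" for b
    proof -
      have "fourier (iter_deriv [b, b] \<phi>) \<xi> = \<i> * complex_of_real (b \<bullet> \<xi>) * (\<i> * complex_of_real (b \<bullet> \<xi>) * fourier \<phi> \<xi>)"
        using fourier_iter_deriv[OF assms that, of "[b]"] fourier_iter_deriv[OF assms that, of "[]"] that by simp
      then have "norm (fourier \<phi> \<xi>) * (b \<bullet> \<xi>)\<^sup>2 = norm (fourier (iter_deriv [b, b] \<phi>) \<xi>)"
        by (simp add: norm_mult power2_eq_square flip: abs_mult)
      also have "\<dots> \<le> I [b, b]" unfolding I_def by (rule norm_fourier_le)
      finally show ?thesis .
    qed
    have "(norm \<xi>)\<^sup>2 = (\<Sum>b\<in>Basis. (b \<bullet> \<xi>)\<^sup>2)"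
      unfolding power2_norm_eq_inner by (subst euclidean_inner) (simp add: power2_eq_square inner_commute)
    then have "norm (fourier \<phi> \<xi>) * (1 + (norm \<xi>)\<^sup>2) = norm (fourier \<phi> \<xi>) + (\<Sum>b\<in>Basis. norm (fourier \<phi> \<xi>) * (b \<bullet> \<xi>)\<^sup>2)"
      by (simp add: distrib_left sum_distrib_left)
    also have "\<dots> \<le> C"
      unfolding C_def using norm_fourier_le[of \<phi> \<xi>] by (intro add_mono sum_mono b) (simp add: I_def)
    finally show ?thesis .
  qed
  then show thesis
    using I0 by (intro that[of C])
      (auto simp: C_def field_simps sum_nonneg add_pos_nonneg)
qed

text \<open>The common form of the three exchanges below: two integrable functions of separate
  variables coupled by a bounded kernel.\<close>

lemma fubini_kernel:
  fixes u :: "'a::euclidean_space \<Rightarrow> complex" and v :: "'b::euclidean_space \<Rightarrow> complex"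
  assumes u: "integrable lborel u" and v: "integrable lborel v"
    and k[measurable]: "(\<lambda>(x, y). k x y) \<in> borel_measurable (lborel \<Otimes>\<^sub>M lborel)"
    and B: "\<And>x y. norm (k x y) \<le> B"
  shows "(\<integral>x. u x * (\<integral>y. v y * k x y \<partial>lborel) \<partial>lborel) = (\<integral>y. v y * (\<integral>x. u x * k x y \<partial>lborel) \<partial>lborel)"
proof -
  have [measurable]: "u \<in> borel_measurable borel" "v \<in> borel_measurable borel"
    using u v by (auto dest: borel_measurable_integrable)
  have B0: "B \<ge> 0" using B[of undefined undefined] norm_ge_zero order_trans by blast
  have "integrable (lborel \<Otimes>\<^sub>M lborel) (\<lambda>(x, y). u x * v y * k x y)"
  proof (rule integrableI_bounded)
    have "(\<integral>\<^sup>+p. norm (case p of (x, y) \<Rightarrow> u x * v y * k x y) \<partial>(lborel \<Otimes>\<^sub>M lborel))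
        = (\<integral>\<^sup>+x. \<integral>\<^sup>+y. norm (u x * v y * k x y) \<partial>lborel \<partial>lborel)"
      by (subst lborel.nn_integral_fst[symmetric]) (auto simp: case_prod_unfold)
    also have "\<dots> \<le> (\<integral>\<^sup>+x. \<integral>\<^sup>+y. ennreal (norm (u x)) * (ennreal (norm (v y)) * ennreal B) \<partial>lborel \<partial>lborel)"
      using B B0 by (intro nn_integral_mono) (auto simp: norm_mult mult.assoc simp flip: ennreal_mult intro!: ennreal_leI mult_left_mono)
    also have "\<dots> = (\<integral>\<^sup>+x. ennreal (norm (u x)) \<partial>lborel) * ((\<integral>\<^sup>+y. ennreal (norm (v y)) \<partial>lborel) * ennreal B)"
      by (simp add: nn_integral_cmult nn_integral_multc)
    also have "\<dots> < \<infinity>"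
      using u v by (simp add: integrable_iff_bounded ennreal_mult_less_top)
    finally show "(\<integral>\<^sup>+p. norm (case p of (x, y) \<Rightarrow> u x * v y * k x y) \<partial>(lborel \<Otimes>\<^sub>M lborel)) < \<infinity>" .
  qed measurable
  from lborel_pair.Fubini_integral[OF this]
  have "(\<integral>x. (\<integral>y. u x * v y * k x y \<partial>lborel) \<partial>lborel) = (\<integral>y. (\<integral>x. u x * v y * k x y \<partial>lborel) \<partial>lborel)" ..
  moreover have "(\<integral>y. u x * v y * k x y \<partial>lborel) = u x * (\<integral>y. v y * k x y \<partial>lborel)" for x
    by (simp add: mult.assoc)
  moreover have "(\<integral>x. u x * v y * k x y \<partial>lborel) = v y * (\<integral>x. u x * k x y \<partial>lborel)" for y
    by (simp add: mult.commute[of "u _" "v _"] mult.assoc)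
  ultimately show ?thesis by simp
qed

section \<open>The convergence factor and its transform\<close>

lemma integrable_gaussian: "\<epsilon> > 0 \<Longrightarrow> integrable lborel (\<lambda>t::real. exp (- (\<epsilon> * t)\<^sup>2 / 2))"
proof -
  assume "\<epsilon> > 0"
  then have "(\<lambda>t::real. exp (- (\<epsilon> * t)\<^sup>2 / 2)) = (\<lambda>t. sqrt (2 * pi * (1 / \<epsilon>)\<^sup>2) * normal_density 0 (1 / \<epsilon>) t)"
    by (intro ext) (simp add: normal_density_def power_mult_distrib power_divide)
  with \<open>\<epsilon> > 0\<close> show ?thesis by simp
qed

text \<open>Substituting t = x / \<epsilon> leads to the characteristic function of the standard
  normal law. One sqrt (2 \<pi>) undoes the normalization of \<open>std_normal_density\<close>, the
  other makes up that of \<open>normal_density 0 \<epsilon>\<close>; together they are the 2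
  \<pi>.\<close>

lemma gaussian_fourier_integral:
  assumes "\<epsilon> > 0"
  shows "(\<integral>t. complex_of_real (exp (- (\<epsilon> * t)\<^sup>2 / 2)) * exp (- (\<i> * complex_of_real (t * s))) \<partial>lborel)
     = complex_of_real (2 * pi * normal_density 0 \<epsilon> s)"
proof -
  have "(\<integral>t. complex_of_real (exp (- (\<epsilon> * t)\<^sup>2 / 2)) * exp (- (\<i> * complex_of_real (t * s))) \<partial>lborel)
     = \<bar>inverse \<epsilon>\<bar> *\<^sub>R (\<integral>x. complex_of_real (exp (- (\<epsilon> * (0 + inverse \<epsilon> * x))\<^sup>2 / 2)) * exp (- (\<i> * complex_of_real ((0 + inverse \<epsilon> * x) * s))) \<partial>lborel)"
    using assms by (intro lborel_integral_real_affine) simp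
  also have "(\<integral>x. complex_of_real (exp (- (\<epsilon> * (0 + inverse \<epsilon> * x))\<^sup>2 / 2)) * exp (- (\<i> * complex_of_real ((0 + inverse \<epsilon> * x) * s))) \<partial>lborel)
     = (\<integral>x. sqrt (2 * pi) *\<^sub>R (std_normal_density x *\<^sub>R iexp (- (s / \<epsilon>) * x)) \<partial>lborel)"
    using assms by (intro Bochner_Integration.integral_cong)
      (auto simp: std_normal_density_def scaleR_conv_of_real field_simps)
  also have "\<dots> = sqrt (2 * pi) *\<^sub>R char std_normal_distribution (- (s / \<epsilon>))"
    unfolding char_def integral_scaleR_right by (subst integral_density) auto
  also have "char std_normal_distribution (- (s / \<epsilon>)) = complex_of_real (exp (- (s / \<epsilon>)\<^sup>2 / 2))"
    by (simp add: char_std_normal_distribution)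
  also have "\<bar>inverse \<epsilon>\<bar> *\<^sub>R sqrt (2 * pi) *\<^sub>R complex_of_real (exp (- (s / \<epsilon>)\<^sup>2 / 2)) = complex_of_real (2 * pi * normal_density 0 \<epsilon> s)"
  proof -
    have "sqrt (2 * pi) * sqrt (2 * pi) = 2 * pi" by simp
    then have "\<bar>inverse \<epsilon>\<bar> * (sqrt (2 * pi) * exp (- (s / \<epsilon>)\<^sup>2 / 2)) = 2 * pi * normal_density 0 \<epsilon> s"
      using assms by (simp add: normal_density_def real_sqrt_mult power_divide field_simps)
    then show ?thesis by (metis of_real_mult scaleR_conv_of_real)
  qed
  finally show ?thesis .
qed

section \<open>Regularization, exchange of the integrals, and passage to the limit\<close>

context homogeneous_gauge
begin

lemma inverse_N_power_le:
  assumes "x \<noteq> 0"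
  shows "inverse (N x ^ k) \<le> R ^ k * inverse (norm x ^ k)"
proof -
  have "norm x ^ k \<le> (R * N x) ^ k" using norm_le by (intro power_mono) auto
  then show ?thesis using assms N_pos[OF assms] by (simp add: field_simps power_mult_distrib)
qed

lemma integrable_gauge_fourier:
  assumes "schwartz \<phi>"
  shows "integrable lborel (\<lambda>x. inverse (N x ^ (DIM('a) - 1)) *\<^sub>R fourier \<phi> x)"
proof -
  obtain C where C: "C \<ge> 0" "\<And>\<xi>. norm (fourier \<phi> \<xi>) \<le> C * inverse (1 + (norm \<xi>)\<^sup>2)"
    using fourier_schwartz_decay[OF dim assms] by blast
  have [measurable]: "\<phi> \<in> borel_measurable borel"
    using schwartz_iter_deriv(3)[OF assms, of "[]"] by simp
  show ?thesis
  proof (rule Bochner_Integration.integrable_bound)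
    show "integrable lborel (\<lambda>x::'a. R ^ (DIM('a) - 1) * C * weight x)"
      using integrable_weight[OF dim] by simp
    show "AE x in lborel. norm (inverse (N x ^ (DIM('a) - 1)) *\<^sub>R fourier \<phi> x) \<le> norm (R ^ (DIM('a) - 1) * C * weight x)"
      using AE_lborel_singleton[of "0::'a"]
    proof eventually_elim
      fix x :: 'a assume x: "x \<noteq> 0"
      have "norm (inverse (N x ^ (DIM('a) - 1)) *\<^sub>R fourier \<phi> x) = inverse (N x ^ (DIM('a) - 1)) * norm (fourier \<phi> x)"
        using N_nonneg by simp
      also have "\<dots> \<le> (R ^ (DIM('a) - 1) * inverse (norm x ^ (DIM('a) - 1))) * (C * inverse (1 + (norm x)\<^sup>2))"
        using C N_nonneg R_pos by (intro mult_mono inverse_N_power_le x) auto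
      also have "\<dots> \<le> norm (R ^ (DIM('a) - 1) * C * weight x)"
        by (simp add: weight_def ac_simps abs_ge_self)
      finally show "norm (inverse (N x ^ (DIM('a) - 1)) *\<^sub>R fourier \<phi> x) \<le> norm (R ^ (DIM('a) - 1) * C * weight x)" .
    qed
  qed measurable
qed

text \<open>The function J of the overview, for w the Fourier transform of \<phi>.\<close>

definition dilate_integral :: "('a \<Rightarrow> complex) \<Rightarrow> real \<Rightarrow> complex" where
  "dilate_integral \<phi> t = (\<integral>y. indicator unit_body y *\<^sub>R fourier \<phi> (t *\<^sub>R y) \<partial>lborel)"

text \<open>The layer cake gives 1 / m times the gauge integral on the positive half line; J is even
  because the body is symmetric, which doubles it.\<close>

lemma gauge_fourier_integral:
  assumes "schwartz \<phi>"
  shows "has_bochner_integral lborel (dilate_integral \<phi>)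
     ((2 / real (DIM('a) - 1)) *\<^sub>R (\<integral>x. inverse (N x ^ (DIM('a) - 1)) *\<^sub>R fourier \<phi> x \<partial>lborel))"
proof -
  let ?J = "dilate_integral \<phi>" and ?m = "DIM('a) - 1"
  let ?I = "\<integral>x. inverse (N x ^ ?m) *\<^sub>R fourier \<phi> x \<partial>lborel"
  have m: "Suc ?m = DIM('a)" "?m > 0" using dim by auto
  have [measurable]: "\<phi> \<in> borel_measurable borel"
    using schwartz_iter_deriv(3)[OF assms, of "[]"] by simp
  have \<Psi>[measurable]: "fourier \<phi> \<in> borel_measurable borel" by measurable
  note L = layer_cake_integral[OF borel_N borel_measurable_fourier N_pos hom m integrable_gauge_fourier[OF assms], folded dilate_integral_def]
  have L': "integrable lborel (\<lambda>t. indicator {0<..} t *\<^sub>R ?J t)" "?I = real ?m *\<^sub>R (\<integral>t. indicator {0<..} t *\<^sub>R ?J t \<partial>lborel)"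
    by (rule L; simp)+
  have even: "?J (- t) = ?J t" for t
  proof -
    have "?J (- t) = (\<bar>-1\<bar> ^ DIM('a)) *\<^sub>R (\<integral>y. indicator unit_body (0 + (-1) *\<^sub>R y) *\<^sub>R fourier \<phi> (- t *\<^sub>R (0 + (-1) *\<^sub>R y)) \<partial>lborel)"
      unfolding dilate_integral_def
    proof (rule lborel_integral_affine)
      have "unit_body \<in> sets borel" by measurable
      then show "(\<lambda>y. indicator unit_body y *\<^sub>R fourier \<phi> (- t *\<^sub>R y)) \<in> borel_measurable borel"
        by (intro borel_measurable_scaleR borel_measurable_indicator measurable_compose[OF _ \<Psi>]) simp_all
    qed simp
    also have "\<dots> = ?J t"
      unfolding dilate_integral_def using hom[of "-1"] by (simp add: indicator_def)
    finally show ?thesis .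
  qed
  have [measurable]: "?J \<in> borel_measurable borel"
    unfolding dilate_integral_def[abs_def] by measurable
  have "has_bochner_integral lborel (\<lambda>t. indicator {0<..} t *\<^sub>R ?J t) (\<integral>t. indicator {0<..} t *\<^sub>R ?J t \<partial>lborel)"
    using L'(1) by (simp add: has_bochner_integral_iff)
  \<comment> \<open>The rule for even functions integrates over the closed half line; the point 0 is
    a null set.\<close>
  also have "?this \<longleftrightarrow> has_bochner_integral lborel (\<lambda>t. indicator {0..} t *\<^sub>R ?J t) (\<integral>t. indicator {0<..} t *\<^sub>R ?J t \<partial>lborel)"
    by (rule has_bochner_integral_cong_AE)
       (use AE_lborel_singleton[of "0::real"] in \<open>auto elim!: eventually_mono simp: indicator_def\<close>)
  finally have "has_bochner_integral lborel (\<lambda>t. indicator {0..} t *\<^sub>R ?J t) (\<integral>t. indicator {0<..} t *\<^sub>R ?J t \<partial>lborel)" .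
  from has_bochner_integral_even_function[OF this even]
  have "has_bochner_integral lborel ?J (2 *\<^sub>R (\<integral>t. indicator {0<..} t *\<^sub>R ?J t \<partial>lborel))" by simp
  also have "2 *\<^sub>R (\<integral>t. indicator {0<..} t *\<^sub>R ?J t \<partial>lborel) = (2 / real ?m) *\<^sub>R ?I"
    unfolding L'(2) using m(2) by (simp del: of_nat_diff)
  finally show ?thesis .
qed

text \<open>With the Gaussian factor every pair of variables is coupled by a bounded kernel.
  Unfolding the transform of \<phi>, integrating over the body first and then over t replaces the
  oscillation by a normal density.\<close>

lemma regularized_dilate_integral:
  assumes "schwartz \<phi>" "\<epsilon> > 0"
  shows "(\<integral>t. exp (- (\<epsilon> * t)\<^sup>2 / 2) *\<^sub>R dilate_integral \<phi> t \<partial>lborel)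
     = (\<integral>\<xi>. \<phi> \<xi> * complex_of_real (2 * pi * smoothed_section \<epsilon> \<xi>) \<partial>lborel)"
proof -
  have \<phi>: "integrable lborel \<phi>"
    using schwartz_integrable[OF dim assms(1), of "[]"] by simp
  then have [measurable]: "\<phi> \<in> borel_measurable borel" by (auto dest: borel_measurable_integrable)
  let ?i = "\<lambda>y. complex_of_real (indicator unit_body y)"
  let ?e = "\<lambda>t::real. complex_of_real (exp (- (\<epsilon> * t)\<^sup>2 / 2))"
  let ?E = "\<lambda>t y \<xi>. exp (- (\<i> * complex_of_real (t * (y \<bullet> \<xi>))))"
  have i: "integrable lborel ?i" using integrable_unit_body by (rule integrable_of_real)
  have e: "integrable lborel ?e" using integrable_gaussian[OF assms(2)] by (rule integrable_of_real)
  \<comment> \<open>The Fourier transform of the indicator of the body at t \<xi>. It is bounded by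
    the volume, so it serves as the kernel coupling t and \<xi>.\<close>
  define Q where "Q t \<xi> = (\<integral>y. ?i y * ?E t y \<xi> \<partial>lborel)" for t \<xi>
  have [measurable]: "(\<lambda>(t, \<xi>). Q t \<xi>) \<in> borel_measurable (lborel \<Otimes>\<^sub>M lborel)"
    unfolding Q_def by measurable
  have Q: "norm (Q t \<xi>) \<le> (\<integral>y. norm (?i y) \<partial>lborel)" for t \<xi>
    unfolding Q_def using integral_norm_bound[of lborel "\<lambda>y. ?i y * ?E t y \<xi>"] by (simp add: norm_mult)
  have J: "dilate_integral \<phi> t = (\<integral>\<xi>. \<phi> \<xi> * Q t \<xi> \<partial>lborel)" for t
  proof -
    have "dilate_integral \<phi> t = (\<integral>y. ?i y * (\<integral>\<xi>. \<phi> \<xi> * ?E t y \<xi> \<partial>lborel) \<partial>lborel)"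
      unfolding dilate_integral_def fourier_def
      by (simp add: scaleR_conv_of_real inner_commute)
    also have "\<dots> = (\<integral>\<xi>. \<phi> \<xi> * Q t \<xi> \<partial>lborel)"
      unfolding Q_def
    proof (rule fubini_kernel[OF i \<phi>, where B = 1])
      show "(\<lambda>(y, \<xi>). ?E t y \<xi>) \<in> borel_measurable (lborel \<Otimes>\<^sub>M lborel)" by measurable
      show "norm (?E t y \<xi>) \<le> 1" for y \<xi> by (simp add: norm_exp_eq_Re)
    qed
    finally show ?thesis .
  qed
  have inner: "(\<integral>t. ?e t * Q t \<xi> \<partial>lborel) = complex_of_real (2 * pi * smoothed_section \<epsilon> \<xi>)" for \<xi>
  proof -
    have "(\<integral>t. ?e t * Q t \<xi> \<partial>lborel) = (\<integral>y. ?i y * (\<integral>t. ?e t * ?E t y \<xi> \<partial>lborel) \<partial>lborel)"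
      unfolding Q_def
    proof (rule fubini_kernel[OF e i, where B = 1])
      show "(\<lambda>(t, y). ?E t y \<xi>) \<in> borel_measurable (lborel \<Otimes>\<^sub>M lborel)" by measurable
      show "norm (?E t y \<xi>) \<le> 1" for t y by (simp add: norm_exp_eq_Re)
    qed
    also have "\<dots> = (\<integral>y. complex_of_real (2 * pi * (indicator unit_body y * normal_density 0 \<epsilon> (y \<bullet> \<xi>))) \<partial>lborel)"
      by (simp only: gaussian_fourier_integral[OF assms(2)]) (simp add: ac_simps)
    also have "\<dots> = complex_of_real (2 * pi * smoothed_section \<epsilon> \<xi>)"
      unfolding smoothed_section_def by (simp only: integral_complex_of_real integral_mult_right_zero)
    finally show ?thesis .
  qed
  have "(\<integral>t. exp (- (\<epsilon> * t)\<^sup>2 / 2) *\<^sub>R dilate_integral \<phi> t \<partial>lborel) = (\<integral>t. ?e t * (\<integral>\<xi>. \<phi> \<xi> * Q t \<xi> \<partial>lborel) \<partial>lborel)"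
    by (simp only: J scaleR_conv_of_real)
  also have "\<dots> = (\<integral>\<xi>. \<phi> \<xi> * (\<integral>t. ?e t * Q t \<xi> \<partial>lborel) \<partial>lborel)"
    by (rule fubini_kernel[OF e \<phi> _ Q]) measurable
  finally show ?thesis by (simp only: inner)
qed

lemma borel_section_function: "section_function \<in> borel_measurable borel"
proof -
  have "(\<lambda>\<xi>. indicator (- {0}) \<xi> *\<^sub>R section_function \<xi>) \<in> borel_measurable borel"
    by (intro borel_measurable_continuous_on_indicator continuous_on_section_function) auto
  also have "(\<lambda>\<xi>. indicator (- {0}) \<xi> *\<^sub>R section_function \<xi>) = section_function"
    by (auto simp: fun_eq_iff indicator_def section_function_def)
  finally show ?thesis .
qed

text \<open>Since 1 / |x| = |x|^(-n+1) |x|^(n-2), a function of order 1 / |x| fits the moderate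
  growth condition with k = n - 2.\<close>

lemma inverse_norm_le_weight:
  assumes "x \<noteq> (0::'a)"
  shows "inverse (norm x) \<le> inverse (norm x ^ (DIM('a) - 1)) * (1 + norm x ^ (DIM('a) - 2))"
proof -
  have "DIM('a) - 1 = Suc (DIM('a) - 2)" using dim by simp
  then show ?thesis using assms by (simp add: field_simps)
qed

text \<open>Both sides of the regularized identity converge as \<epsilon> tends to 0: the left one
  is dominated by |J|, the right one by (2 R)^(n-1) |\<phi>(\<xi>)| / |\<xi>| up to 2 \<pi>. Solving
  for the gauge integral multiplies 2 \<pi> by m / 2.\<close>

lemma integral_gauge_fourier:
  assumes "schwartz \<phi>"
  shows "(\<integral>x. inverse (N x ^ (DIM('a) - 1)) *\<^sub>R fourier \<phi> x \<partial>lborel)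
    = (\<integral>\<xi>. complex_of_real (pi * real (DIM('a) - 1) * section_function \<xi>) * \<phi> \<xi> \<partial>lborel)"
proof -
  let ?m = "DIM('a) - 1"
  let ?I = "\<integral>x. inverse (N x ^ ?m) *\<^sub>R fourier \<phi> x \<partial>lborel"
  note [measurable] = borel_section_function
  have [measurable]: "\<phi> \<in> borel_measurable borel"
    using schwartz_iter_deriv(3)[OF assms, of "[]"] by simp
  define \<epsilon> where "\<epsilon> n = inverse (real (Suc n))" for n
  have \<epsilon>: "\<epsilon> \<longlonglongrightarrow> 0" "\<And>n. \<epsilon> n > 0"
    unfolding \<epsilon>_def[abs_def] by (rule LIMSEQ_inverse_real_of_nat) simp
  note J = gauge_fourier_integral[OF assms]
  have [measurable]: "dilate_integral \<phi> \<in> borel_measurable borel"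
    using J by (auto dest: borel_measurable_has_bochner_integral)
  have "(\<lambda>n. \<integral>t. exp (- (\<epsilon> n * t)\<^sup>2 / 2) *\<^sub>R dilate_integral \<phi> t \<partial>lborel) \<longlonglongrightarrow> (\<integral>t. dilate_integral \<phi> t \<partial>lborel)"
  proof (rule integral_dominated_convergence[where w = "\<lambda>t. norm (dilate_integral \<phi> t)"])
    show "integrable lborel (\<lambda>t. norm (dilate_integral \<phi> t))"
      using J by (intro integrable_norm) (simp add: has_bochner_integral_iff)
    have "(\<lambda>n. exp (- (\<epsilon> n * t)\<^sup>2 / 2) *\<^sub>R dilate_integral \<phi> t) \<longlonglongrightarrow> exp (- (0 * t)\<^sup>2 / 2) *\<^sub>R dilate_integral \<phi> t" for t
      by (intro tendsto_intros \<epsilon>) auto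
    then show "AE t in lborel. (\<lambda>n. exp (- (\<epsilon> n * t)\<^sup>2 / 2) *\<^sub>R dilate_integral \<phi> t) \<longlonglongrightarrow> dilate_integral \<phi> t"
      by simp
    show "AE t in lborel. norm (exp (- (\<epsilon> n * t)\<^sup>2 / 2) *\<^sub>R dilate_integral \<phi> t) \<le> norm (dilate_integral \<phi> t)" for n
      by (intro AE_I2) (auto intro: mult_left_le_one_le)
  qed measurable
  then have 1: "(\<lambda>n. \<integral>\<xi>. \<phi> \<xi> * complex_of_real (2 * pi * smoothed_section (\<epsilon> n) \<xi>) \<partial>lborel) \<longlonglongrightarrow> (2 / real ?m) *\<^sub>R ?I"
    using regularized_dilate_integral[OF assms \<epsilon>(2)] has_bochner_integral_integral_eq[OF J] by simp
  have 2: "(\<lambda>n. \<integral>\<xi>. \<phi> \<xi> * complex_of_real (2 * pi * smoothed_section (\<epsilon> n) \<xi>) \<partial>lborel) \<longlonglongrightarrow>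
     (\<integral>\<xi>. \<phi> \<xi> * complex_of_real (2 * pi * section_function \<xi>) \<partial>lborel)"
  proof (rule integral_dominated_convergence[where w = "\<lambda>\<xi>. 2 * pi * (2 * R) ^ ?m * norm (complex_of_real (inverse (norm \<xi>)) * iter_deriv [] \<phi> \<xi>)"])
    have "integrable lborel (\<lambda>\<xi>. complex_of_real (inverse (norm \<xi>)) * iter_deriv [] \<phi> \<xi>)"
    proof (rule integrable_mult_iter_deriv(1)[OF dim assms, where C = 1 and k = "DIM('a) - 2"])
      fix x :: 'a assume "x \<noteq> 0"
      from inverse_norm_le_weight[OF this]
      show "norm (complex_of_real (inverse (norm x))) \<le> 1 * inverse (norm x ^ ?m) * (1 + norm x ^ (DIM('a) - 2))"
        by (simp add: norm_inverse)
    qed auto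
    then show "integrable lborel (\<lambda>\<xi>. 2 * pi * (2 * R) ^ ?m * norm (complex_of_real (inverse (norm \<xi>)) * iter_deriv [] \<phi> \<xi>))"
      by (intro Bochner_Integration.integrable_mult_right integrable_norm)
    show "AE \<xi> in lborel. (\<lambda>n. \<phi> \<xi> * complex_of_real (2 * pi * smoothed_section (\<epsilon> n) \<xi>)) \<longlonglongrightarrow> \<phi> \<xi> * complex_of_real (2 * pi * section_function \<xi>)"
      using AE_lborel_singleton[of "0::'a"]
      by eventually_elim (intro tendsto_intros smoothed_section_tendsto \<epsilon>)
    show "AE \<xi> in lborel. norm (\<phi> \<xi> * complex_of_real (2 * pi * smoothed_section (\<epsilon> n) \<xi>)) \<le>
        2 * pi * (2 * R) ^ ?m * norm (complex_of_real (inverse (norm \<xi>)) * iter_deriv [] \<phi> \<xi>)" for n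
      using AE_lborel_singleton[of "0::'a"]
    proof eventually_elim
      fix \<xi> :: 'a assume \<xi>: "\<xi> \<noteq> 0"
      have s: "norm (sgn \<xi>) = 1" "\<epsilon> n / norm \<xi> > 0" using \<xi> \<epsilon>(2)[of n] by (auto simp: norm_sgn)
      have "\<bar>smoothed_section (\<epsilon> n) \<xi>\<bar> \<le> inverse (norm \<xi>) * (2 * R) ^ ?m"
        unfolding smoothed_section_rescale[OF \<xi> \<epsilon>(2)] using smoothed_section_le[OF s]
        by (simp add: abs_mult mult_left_mono)
      then have "2 * pi * norm (\<phi> \<xi>) * \<bar>smoothed_section (\<epsilon> n) \<xi>\<bar> \<le> 2 * pi * norm (\<phi> \<xi>) * (inverse (norm \<xi>) * (2 * R) ^ ?m)"
        by (intro mult_left_mono) auto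
      then show "norm (\<phi> \<xi> * complex_of_real (2 * pi * smoothed_section (\<epsilon> n) \<xi>)) \<le>
        2 * pi * (2 * R) ^ ?m * norm (complex_of_real (inverse (norm \<xi>)) * iter_deriv [] \<phi> \<xi>)"
        by (simp add: norm_mult norm_inverse abs_mult ac_simps)
    qed
    show "(\<lambda>\<xi>. \<phi> \<xi> * complex_of_real (2 * pi * smoothed_section (\<epsilon> n) \<xi>)) \<in> borel_measurable lborel" for n
      using borel_measurable_continuous_onI[OF continuous_on_smoothed_section[OF \<epsilon>(2)], of n] by measurable
  qed measurable
  have "?I = (real ?m / 2) *\<^sub>R ((2 / real ?m) *\<^sub>R ?I)" using dim by (simp del: of_nat_diff)
  also have "\<dots> = (real ?m / 2) *\<^sub>R (\<integral>\<xi>. \<phi> \<xi> * complex_of_real (2 * pi * section_function \<xi>) \<partial>lborel)"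
    using LIMSEQ_unique[OF 1 2] by simp
  also have "\<dots> = (\<integral>\<xi>. (real ?m / 2) *\<^sub>R (\<phi> \<xi> * complex_of_real (2 * pi * section_function \<xi>)) \<partial>lborel)"
    by (rule integral_scaleR_right[symmetric])
  also have "\<dots> = (\<integral>\<xi>. complex_of_real (pi * real ?m * section_function \<xi>) * \<phi> \<xi> \<partial>lborel)"
    by (intro Bochner_Integration.integral_cong refl) (simp add: scaleR_conv_of_real ac_simps)
  finally show ?thesis .
qed

end

section \<open>Gaussians as test functions\<close>

text \<open>Fixing the direction v and varying the base point keeps the derivative polynomial; this
  is the form in which iterated partial derivatives consume it.\<close>

lemma real_polynomial_function_has_derivative:
  fixes P :: "'a::real_normed_vector \<Rightarrow> real"
  assumes "real_polynomial_function P"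
  shows "\<exists>D. (\<forall>x. (P has_derivative D x) (at x)) \<and> (\<forall>v. real_polynomial_function (\<lambda>x. D x v))"
  using assms
proof induction
  case (linear f)
  then show ?case by (intro exI[of _ "\<lambda>_. f"]) (auto intro: bounded_linear_imp_has_derivative)
next
  case (const c)
  show ?case by (intro exI[of _ "\<lambda>_ _. 0"]) auto
next
  case (add f g)
  then obtain D E where "\<And>x. (f has_derivative D x) (at x)" "\<And>v. real_polynomial_function (\<lambda>x. D x v)"
    "\<And>x. (g has_derivative E x) (at x)" "\<And>v. real_polynomial_function (\<lambda>x. E x v)" by blast
  then show ?case by (intro exI[of _ "\<lambda>x v. D x v + E x v"]) (auto intro: has_derivative_add)
next
  case (mult f g)
  then obtain D E where "\<And>x. (f has_derivative D x) (at x)" "\<And>v. real_polynomial_function (\<lambda>x. D x v)"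
    "\<And>x. (g has_derivative E x) (at x)" "\<And>v. real_polynomial_function (\<lambda>x. E x v)" by blast
  with mult.hyps show ?case
    by (intro exI[of _ "\<lambda>x v. f x * E x v + D x v * g x"] conjI allI has_derivative_mult real_polynomial_function.intros(3,4))
qed

lemma real_polynomial_function_growth:
  fixes P :: "'a::real_normed_vector \<Rightarrow> real"
  assumes "real_polynomial_function P"
  shows "\<exists>C k. \<forall>x. \<bar>P x\<bar> \<le> C * (1 + norm x) ^ k"
  using assms
proof induction
  case (linear f)
  obtain K where K: "K > 0" "\<And>x. norm (f x) \<le> norm x * K"
    using bounded_linear.pos_bounded[OF linear] by blast
  have "\<bar>f x\<bar> \<le> K * (1 + norm x) ^ 1" for x
    using K(2)[of x] K(1) by (simp add: algebra_simps)
  then show ?case by blast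
next
  case (const c)
  have "\<bar>c\<bar> \<le> \<bar>c\<bar> * (1 + norm x) ^ 0" for x :: 'a by simp
  then show ?case by blast
next
  case (add f g)
  then obtain C k C' k' where *: "\<And>x. \<bar>f x\<bar> \<le> C * (1 + norm x) ^ k" "\<And>x. \<bar>g x\<bar> \<le> C' * (1 + norm x) ^ k'" by blast
  have "\<bar>f x + g x\<bar> \<le> (\<bar>C\<bar> + \<bar>C'\<bar>) * (1 + norm x) ^ (k + k')" for x
  proof -
    have "C * (1 + norm x) ^ k \<le> \<bar>C\<bar> * (1 + norm x) ^ (k + k')"
      by (intro mult_mono power_increasing) auto
    moreover have "C' * (1 + norm x) ^ k' \<le> \<bar>C'\<bar> * (1 + norm x) ^ (k + k')"
      by (intro mult_mono power_increasing) auto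
    ultimately show ?thesis using *[of x] by (simp add: distrib_right)
  qed
  then show ?case by blast
next
  case (mult f g)
  then obtain C k C' k' where *: "\<And>x. \<bar>f x\<bar> \<le> C * (1 + norm x) ^ k" "\<And>x. \<bar>g x\<bar> \<le> C' * (1 + norm x) ^ k'" by blast
  have "\<bar>f x * g x\<bar> \<le> (C * C') * (1 + norm x) ^ (k + k')" for x
  proof -
    have "\<bar>f x\<bar> * \<bar>g x\<bar> \<le> (C * (1 + norm x) ^ k) * (C' * (1 + norm x) ^ k')"
      using *(1)[of x] *(2)[of x] order_trans[OF abs_ge_zero *(1)[of x]] by (intro mult_mono) auto
    then show ?thesis by (simp add: abs_mult power_add ac_simps)
  qed
  then show ?case by blast
qed

lemma real_polynomial_function_norm_diff_square:
  fixes p :: "'a::euclidean_space"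
  shows "real_polynomial_function (\<lambda>x. (norm (x - p))\<^sup>2)"
proof -
  have "real_polynomial_function (\<lambda>x. \<Sum>b\<in>Basis. (x \<bullet> b + - (p \<bullet> b)) * (x \<bullet> b + - (p \<bullet> b)))"
    by (intro real_polynomial_function_sum real_polynomial_function.intros bounded_linear_inner_left finite_Basis)
  also have "(\<lambda>x. \<Sum>b\<in>Basis. (x \<bullet> b + - (p \<bullet> b)) * (x \<bullet> b + - (p \<bullet> b))) = (\<lambda>x. (norm (x - p))\<^sup>2)"
    unfolding power2_norm_eq_inner by (subst euclidean_inner) (simp add: inner_diff_left)
  finally show ?thesis .
qed

definition gaussian :: "real \<Rightarrow> 'a::euclidean_space \<Rightarrow> 'a \<Rightarrow> real" where
  "gaussian k p x = exp (- (k * (norm (x - p))\<^sup>2))"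

text \<open>The polynomial factor is there for the induction: polynomials times a fixed Gaussian are
  closed under differentiation, so every iterated derivative has the same shape and one growth
  estimate serves all.\<close>

lemma schwartz_polynomial_gaussian:
  fixes p :: "'a::euclidean_space"
  assumes "k \<ge> 1" and P: "real_polynomial_function P"
  shows "schwartz (\<lambda>x. complex_of_real (P x * gaussian k p x))"
proof -
  have "real_polynomial_function (\<lambda>x. k * (norm (x - p))\<^sup>2)"
    by (intro real_polynomial_function.intros real_polynomial_function_norm_diff_square)
  from real_polynomial_function_has_derivative[OF this] obtain Dq where
    Dq: "\<And>x. ((\<lambda>x. k * (norm (x - p))\<^sup>2) has_derivative Dq x) (at x)" "\<And>v. real_polynomial_function (\<lambda>x. Dq x v)"
    by blast
  have step: "\<exists>D. (\<forall>x. ((\<lambda>x. complex_of_real (P x * gaussian k p x)) has_derivative (\<lambda>v. complex_of_real (D x v * gaussian k p x))) (at x))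
      \<and> (\<forall>v. real_polynomial_function (\<lambda>x. D x v))"
    if poly: "real_polynomial_function P" for P
  proof -
    obtain D where D: "\<And>x. (P has_derivative D x) (at x)" "\<And>v. real_polynomial_function (\<lambda>x. D x v)"
      using real_polynomial_function_has_derivative[OF poly] by blast
    have "((\<lambda>x. complex_of_real (P x * gaussian k p x)) has_derivative (\<lambda>v. complex_of_real ((D x v + (-1) * (P x * Dq x v)) * gaussian k p x))) (at x)" for x
      unfolding gaussian_def
      by (rule has_derivative_eq_rhs, (rule derivative_intros D Dq)+) (auto simp: fun_eq_iff algebra_simps)
    moreover have "real_polynomial_function (\<lambda>x. D x v + (-1) * (P x * Dq x v))" for v
      by (intro real_polynomial_function.intros(2-4) D Dq poly)
    ultimately show ?thesis by (intro exI[of _ "\<lambda>x v. D x v + (-1) * (P x * Dq x v)"]) blast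
  qed
  have ex: "\<exists>Q. real_polynomial_function Q \<and> iter_deriv vs (\<lambda>x. complex_of_real (P x * gaussian k p x)) = (\<lambda>x. complex_of_real (Q x * gaussian k p x))" for vs
  proof (induction vs)
    case Nil
    show ?case using P by auto
  next
    case (Cons v vs)
    then obtain Q where Q: "real_polynomial_function Q"
      "iter_deriv vs (\<lambda>x. complex_of_real (P x * gaussian k p x)) = (\<lambda>x. complex_of_real (Q x * gaussian k p x))" by blast
    from step[OF Q(1)] obtain D where
      D: "\<And>x. ((\<lambda>x. complex_of_real (Q x * gaussian k p x)) has_derivative (\<lambda>v. complex_of_real (D x v * gaussian k p x))) (at x)"
      "\<And>v. real_polynomial_function (\<lambda>x. D x v)" by blast
    show ?case
      by (intro exI[of _ "\<lambda>x. D x v"]) (simp only: iter_deriv.simps Q(2) frechet_derivative_at[OF D(1), symmetric] D(2) simp_thms)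
  qed
  have "iter_deriv vs (\<lambda>x. complex_of_real (P x * gaussian k p x)) differentiable (at x)" for vs x
    using ex[of vs] step unfolding differentiable_def by metis
  moreover have "bounded (range (\<lambda>x. norm x ^ m *\<^sub>R iter_deriv vs (\<lambda>x. complex_of_real (P x * gaussian k p x)) x))" for m vs
  proof -
    obtain Q where Q: "real_polynomial_function Q"
      "iter_deriv vs (\<lambda>x. complex_of_real (P x * gaussian k p x)) = (\<lambda>x. complex_of_real (Q x * gaussian k p x))"
      using ex by blast
    obtain C l where C: "\<And>x. \<bar>Q x\<bar> \<le> C * (1 + norm x) ^ l"
      using real_polynomial_function_growth[OF Q(1)] by blast
    have C0: "C \<ge> 0" using order_trans[OF abs_ge_zero C[of 0]] by simp
    define j where "j = m + l"
    have "norm (norm x ^ m *\<^sub>R complex_of_real (Q x * gaussian k p x)) \<le> C * ((1 + norm p) ^ j * exp ((real j)\<^sup>2))" for x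
    proof -
      define r where "r = norm (x - p)"
      \<comment> \<open>For r \<le> j drop the quadratic term and use j r \<le> j^2; for r > j it
        beats the linear one because k \<ge> 1.\<close>
      have "real j * r - k * r\<^sup>2 \<le> (real j)\<^sup>2"
      proof (cases "r \<le> real j")
        case True
        then have "real j * r \<le> (real j)\<^sup>2" by (simp add: power2_eq_square mult_left_mono)
        moreover have "k * r\<^sup>2 \<ge> 0" using \<open>k \<ge> 1\<close> by simp
        ultimately show ?thesis by linarith
      next
        case False
        then have "real j * r \<le> 1 * r\<^sup>2" by (simp add: power2_eq_square mult_right_mono r_def)
        also have "\<dots> \<le> k * r\<^sup>2" using \<open>k \<ge> 1\<close> by (intro mult_right_mono) auto
        finally show ?thesis using zero_le_power2[of "real j"] by linarith
      qed
      then have e: "exp (real j * r) * gaussian k p x \<le> exp ((real j)\<^sup>2)"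
        by (simp add: gaussian_def r_def[symmetric] flip: exp_add)
      \<comment> \<open>Recentring at p costs only the factor 1 + |p|; then 1 + r \<le> exp r turns
        polynomial growth into exp (j r), which the Gaussian absorbs.\<close>
      have "1 + norm x \<le> 1 + norm p + r"
        using norm_triangle_ineq[of "x - p" p] by (simp add: r_def)
      also have "\<dots> \<le> (1 + norm p) * (1 + r)" by (simp add: algebra_simps r_def)
      also have "\<dots> \<le> (1 + norm p) * exp r" by (intro mult_left_mono exp_ge_add_one_self) auto
      finally have "(1 + norm x) ^ j \<le> ((1 + norm p) * exp r) ^ j" by (intro power_mono) auto
      also have "\<dots> = (1 + norm p) ^ j * exp (real j * r)"
        by (simp add: power_mult_distrib exp_of_nat_mult)
      finally have x: "(1 + norm x) ^ j \<le> (1 + norm p) ^ j * exp (real j * r)" .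
      have "norm x ^ m * \<bar>Q x\<bar> \<le> (1 + norm x) ^ m * (C * (1 + norm x) ^ l)"
        using C by (intro mult_mono power_mono) auto
      also have "\<dots> = C * (1 + norm x) ^ j" by (simp add: j_def power_add)
      also have "\<dots> \<le> C * ((1 + norm p) ^ j * exp (real j * r))" using x C0 by (rule mult_left_mono)
      finally have "norm x ^ m * \<bar>Q x\<bar> * gaussian k p x \<le> C * ((1 + norm p) ^ j * exp (real j * r)) * gaussian k p x"
        by (intro mult_right_mono) (auto simp: gaussian_def)
      also have "\<dots> = C * ((1 + norm p) ^ j * (exp (real j * r) * gaussian k p x))" by simp
      also have "\<dots> \<le> C * ((1 + norm p) ^ j * exp ((real j)\<^sup>2))"
        using C0 e by (intro mult_left_mono) auto
      finally show ?thesis by (simp add: norm_mult gaussian_def abs_mult mult.assoc)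
    qed
    then show ?thesis unfolding Q(2) bounded_iff by blast
  qed
  ultimately show ?thesis unfolding schwartz_def smooth_def by blast
qed

text \<open>Testing against \<open>exp (- k \<parallel>x - p\<parallel>\<^sup>2)\<close>, rescaled to be at least \<open>1\<close> near \<open>p\<close>, isolates the sign of
  a function at \<open>p\<close> as \<open>k \<longrightarrow> \<infinity>\<close>: away from \<open>p\<close> the integrand decays uniformly relative to the
  integrable one with \<open>k = 1\<close>.\<close>

lemma gaussian_test_nonpos:
  fixes u :: "'a::euclidean_space \<Rightarrow> real"
  assumes int: "\<And>k::nat. (1::nat) \<le> k \<Longrightarrow> integrable lborel (\<lambda>x. u x * gaussian (real k) p x)"
    and zero: "\<And>k::nat. (1::nat) \<le> k \<Longrightarrow> (\<integral>x. u x * gaussian (real k) p x \<partial>lborel) = 0"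
    and cont: "isCont u p"
  shows "u p \<le> 0"
proof (rule ccontr)
  assume "\<not> u p \<le> 0"
  define c where "c = u p / 2"
  have c: "c > 0" "c < u p" using \<open>\<not> u p \<le> 0\<close> by (auto simp: c_def)
  from cont have "\<forall>\<^sub>F x in at p. c < u x"
    unfolding isCont_def using c(2) by (rule order_tendstoD(1))
  then obtain \<delta> where \<delta>: "\<delta> > 0" "\<And>x. x \<noteq> p \<Longrightarrow> dist x p < \<delta> \<Longrightarrow> c < u x"
    unfolding eventually_at by blast
  have u: "c \<le> u x" if "norm (x - p) < \<delta>" for x
    using \<delta>(2)[of x] that c(2) by (cases "x = p") (auto simp: dist_norm)
  \<comment> \<open>Two radii are needed: the rescaled Gaussian is at least 1 within r, and
    uniformly small beyond \<delta> = 2 r.\<close>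
  define r where "r = \<delta> / 2"
  have r: "r > 0" "\<delta> = 2 * r" using \<delta>(1) by (auto simp: r_def)
  define T where "T k x = u x * gaussian (real k) p x * exp (real k * r\<^sup>2)" for k x
  have T: "T k x = u x * exp (real k * (r\<^sup>2 - (norm (x - p))\<^sup>2))" for k x
    by (simp add: T_def gaussian_def algebra_simps flip: exp_add)
  have Tint: "integrable lborel (T k)" "(\<integral>x. T k x \<partial>lborel) = 0" if "k \<ge> 1" for k
    using int[OF that] zero[OF that] unfolding T_def by auto
  define V where "V = measure lborel (cball p r)"
  have V: "V > 0" using r(1) by (simp add: V_def content_cball)
  have "c * V \<le> exp (- (3 * r\<^sup>2)) ^ k * (\<integral>x. \<bar>T 1 x\<bar> \<partial>lborel)" for k
  proof -
    \<comment> \<open>Within r the integrand is at least c; between r and \<delta> it is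
      nonnegative; beyond \<delta> the exponent r^2 - s^2 is at most r^2 - 4 r^2 = -3 r^2. Of the
      \<open>Suc k\<close> exponential factors one stays in \<open>T 1\<close> to keep it integrable
      and the other k give the geometric decay.\<close>
    have "c * indicator (cball p r) x - exp (- (3 * r\<^sup>2)) ^ k * \<bar>T 1 x\<bar> \<le> T (Suc k) x" for x
    proof -
      let ?s = "norm (x - p)"
      have nn: "exp (- (3 * r\<^sup>2)) ^ k * \<bar>T 1 x\<bar> \<ge> 0" by simp
      consider "?s \<le> r" | "?s > r" "?s < \<delta>" | "?s \<ge> \<delta>" by linarith
      then show ?thesis
      proof cases
        case 1
        then have "?s\<^sup>2 \<le> r\<^sup>2" by (intro power_mono) auto
        then have "1 \<le> exp (real (Suc k) * (r\<^sup>2 - ?s\<^sup>2))" by simp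
        then have "c * 1 \<le> u x * exp (real (Suc k) * (r\<^sup>2 - ?s\<^sup>2))"
          using u[of x] 1 r c by (intro mult_mono) auto
        then have "c \<le> T (Suc k) x" by (simp only: T mult_1_right)
        moreover have "c * indicator (cball p r) x = c" using 1 by (simp add: dist_norm norm_minus_commute)
        ultimately show ?thesis using nn by linarith
      next
        case 2
        then have "T (Suc k) x \<ge> 0" using u[of x] c by (simp add: T)
        moreover have "c * indicator (cball p r) x = 0" using 2 by (simp add: dist_norm norm_minus_commute)
        ultimately show ?thesis using nn by linarith
      next
        case 3
        then have "\<delta>\<^sup>2 \<le> ?s\<^sup>2" using \<delta>(1) by (intro power_mono) auto
        then have "r\<^sup>2 - ?s\<^sup>2 \<le> - (3 * r\<^sup>2)" by (simp add: r(2) power_mult_distrib)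
        then have "exp (r\<^sup>2 - ?s\<^sup>2) ^ k \<le> exp (- (3 * r\<^sup>2)) ^ k" by (intro power_mono) auto
        then have "\<bar>T 1 x\<bar> * exp (r\<^sup>2 - ?s\<^sup>2) ^ k \<le> \<bar>T 1 x\<bar> * exp (- (3 * r\<^sup>2)) ^ k" by (intro mult_left_mono) auto
        moreover have "\<bar>T (Suc k) x\<bar> = \<bar>T 1 x\<bar> * exp (r\<^sup>2 - ?s\<^sup>2) ^ k"
          by (simp add: T abs_mult distrib_right exp_add exp_of_nat_mult)
        moreover have "x \<notin> cball p r" using 3 r by (auto simp: dist_norm norm_minus_commute)
        ultimately show ?thesis by (simp add: mult.commute)
      qed
    qed
    moreover have I: "integrable lborel (\<lambda>x. c * indicator (cball p r) x :: real)"
      using emeasure_lborel_cball_finite[of p r] by (intro Bochner_Integration.integrable_mult_right integrable_real_indicator) auto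
    moreover have I': "integrable lborel (\<lambda>x. exp (- (3 * r\<^sup>2)) ^ k * \<bar>T 1 x\<bar>)"
      using Tint(1)[of 1] by (intro Bochner_Integration.integrable_mult_right integrable_abs) auto
    ultimately have "(\<integral>x. c * indicator (cball p r) x - exp (- (3 * r\<^sup>2)) ^ k * \<bar>T 1 x\<bar> \<partial>lborel) \<le> (\<integral>x. T (Suc k) x \<partial>lborel)"
      using Tint(1)[of "Suc k"] by (intro integral_mono Bochner_Integration.integrable_diff) auto
    then have "(\<integral>x. c * indicator (cball p r) x \<partial>lborel) - (\<integral>x. exp (- (3 * r\<^sup>2)) ^ k * \<bar>T 1 x\<bar> \<partial>lborel) \<le> 0"
      using Tint(2)[of "Suc k"] I I' by (simp add: Bochner_Integration.integral_diff)
    then show ?thesis by (simp add: V_def)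
  qed
  moreover have "(\<lambda>k. exp (- (3 * r\<^sup>2)) ^ k * (\<integral>x. \<bar>T 1 x\<bar> \<partial>lborel)) \<longlonglongrightarrow> 0 * (\<integral>x. \<bar>T 1 x\<bar> \<partial>lborel)"
    using r(1) by (intro tendsto_intros LIMSEQ_realpow_zero) auto
  ultimately have "c * V \<le> 0"
    by (intro LIMSEQ_le_const[where X = "\<lambda>k. exp (- (3 * r\<^sup>2)) ^ k * (\<integral>x. \<bar>T 1 x\<bar> \<partial>lborel)"]) auto
  with c(1) V show False by (simp add: mult_le_0_iff)
qed

text \<open>Equality of the distributions is tested only on Gaussians centred at p, so continuity at
  the single point p suffices.\<close>

lemma tempered_function_eqI:
  fixes g h :: "'a::euclidean_space \<Rightarrow> complex"
  assumes g: "tempered_function g" and h: "tempered_function h"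
    and eq: "\<And>\<phi>. schwartz \<phi> \<Longrightarrow> distribution_of g \<phi> = distribution_of h \<phi>"
    and cont: "isCont g p" "isCont h p"
  shows "g p = h p"
proof -
  \<comment> \<open>With this multiplier u(p) is the squared modulus of g(p) - h(p), so the
    one-sided bound u(p) \<le> 0 already forces equality.\<close>
  define z where "z = cnj (g p - h p)"
  define u where "u x = Re (z * (g x - h x))" for x
  have S: "schwartz (\<lambda>x. complex_of_real (gaussian (real k) p x))" if "k \<ge> 1" for k :: nat
    using schwartz_polynomial_gaussian[of "real k" "\<lambda>_. 1" p] that by auto
  have "has_bochner_integral lborel (\<lambda>x. u x * gaussian (real k) p x) 0" if "k \<ge> 1" for k :: nat
  proof -
    let ?G = "\<lambda>x. complex_of_real (gaussian (real k) p x)"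
    have "has_bochner_integral lborel (\<lambda>x. g x * ?G x) (distribution_of g ?G)"
      "has_bochner_integral lborel (\<lambda>x. h x * ?G x) (distribution_of h ?G)"
      using g h S[OF that] unfolding tempered_function_def distribution_of_def by (auto simp: has_bochner_integral_iff)
    then have "has_bochner_integral lborel (\<lambda>x. g x * ?G x - h x * ?G x) (distribution_of g ?G - distribution_of h ?G)"
      by (rule has_bochner_integral_diff)
    then have "has_bochner_integral lborel (\<lambda>x. Re (z * (g x * ?G x - h x * ?G x))) (Re (z * (distribution_of g ?G - distribution_of h ?G)))"
      by (intro has_bochner_integral_Re has_bochner_integral_mult_right)
    also have "(\<lambda>x. Re (z * (g x * ?G x - h x * ?G x))) = (\<lambda>x. u x * gaussian (real k) p x)"
      by (simp add: u_def fun_eq_iff algebra_simps)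
    finally show ?thesis using eq[OF S[OF that]] by simp
  qed
  moreover have "isCont u p"
    using cont unfolding u_def isCont_def by (intro tendsto_intros)
  ultimately have "u p \<le> 0"
    by (intro gaussian_test_nonpos) (auto simp: has_bochner_integral_iff)
  moreover have "u p = (norm (g p - h p))\<^sup>2"
    unfolding u_def z_def by (subst mult.commute) (simp only: complex_norm_square[symmetric] Re_complex_of_real)
  ultimately show ?thesis by simp
qed

section \<open>Star bodies\<close>

text \<open>If the infimum is below 1, some a < 1 has x in aK and star-shapedness applies. On the
  boundary level 1 the point is a limit of its contractions, and K is closed.\<close>

lemma centrally_symmetric_star_body_eq:
  fixes K :: "'a::euclidean_space set"
  assumes K: "centrally_symmetric_star_body K"
  shows "K = {x. norming K x \<le> 1}"
proof -
  have hom: "norming K (c *\<^sub>R x) = \<bar>c\<bar> * norming K x" and "compact K"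
    and seg: "x \<in> K \<Longrightarrow> closed_segment 0 x \<subseteq> K" and "0 \<in> interior K" for c x
    using K by (auto simp: centrally_symmetric_star_body_def)
  then obtain e where e: "e > 0" "ball 0 e \<subseteq> K" by (auto simp: mem_interior)
  let ?S = "\<lambda>x. {a. a > 0 \<and> x \<in> (\<lambda>y. a *\<^sub>R y) ` K}"
  \<comment> \<open>A neighbourhood of 0 inside K keeps the infimum from being taken over the empty
    set, where it would be uninformative.\<close>
  have ne: "?S x \<noteq> {}" for x
  proof -
    \<comment> \<open>The summand 1 makes a positive even at x = 0 and puts x / a strictly inside
      the ball of radius e.\<close>
    define a where "a = (norm x + 1) / e"
    have a: "a > 0" "norm x < a * e" using e(1) by (auto simp: a_def add_nonneg_pos)
    then have "inverse a *\<^sub>R x \<in> K" using e(2) by (auto simp: subset_iff field_simps)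
    then have "a \<in> ?S x" using a(1) by (auto simp: image_iff intro!: bexI[of _ "inverse a *\<^sub>R x"])
    then show ?thesis by blast
  qed
  have le: "norming K x \<le> 1" if "x \<in> K" for x
    unfolding norming_def using that by (intro cInf_lower) (auto intro!: bdd_belowI[of _ 0])
  have lt: "x \<in> K" if less: "norming K x < 1" for x
  proof -
    obtain a where "a \<in> ?S x" "a < 1"
      using cInf_lessD[OF ne less[unfolded norming_def]] by blast
    then obtain y where "x = a *\<^sub>R y" "y \<in> K" "0 < a" "a < 1" by auto
    then have "x \<in> closed_segment 0 y" by (auto simp: in_segment intro!: exI[of _ a])
    then show ?thesis using seg[OF \<open>y \<in> K\<close>] by blast
  qed
  have "x \<in> K" if "norming K x \<le> 1" for x
  proof -
    let ?r = "\<lambda>n. 1 - inverse (real (Suc n))"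
    have "?r n *\<^sub>R x \<in> K" for n
    proof (rule lt)
      have "\<bar>?r n\<bar> < 1" by (simp add: field_simps abs_if)
      moreover have "\<bar>?r n\<bar> * norming K x \<le> \<bar>?r n\<bar> * 1" using that by (intro mult_left_mono) auto
      ultimately show "norming K (?r n *\<^sub>R x) < 1" by (simp add: hom)
    qed
    moreover have "(\<lambda>n. ?r n *\<^sub>R x) \<longlonglongrightarrow> (1 - 0) *\<^sub>R x"
      by (intro tendsto_intros LIMSEQ_inverse_real_of_nat)
    ultimately show ?thesis
      using closed_sequentially[OF compact_imp_closed[OF \<open>compact K\<close>], of "\<lambda>n. ?r n *\<^sub>R x" "(1 - 0) *\<^sub>R x"] by simp
  qed
  with le show ?thesis by blast
qed

text \<open>R is a bound for K; if |x| exceeded R times the gauge, a suitable multiple of x would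
  lie in K but outside the ball of radius R.\<close>

lemma centrally_symmetric_star_body_gauge:
  fixes K :: "'a::euclidean_space set"
  assumes K: "centrally_symmetric_star_body K" and "DIM('a) > 1"
  obtains R where "homogeneous_gauge (norming K) R"
proof -
  have hom: "\<And>c x. norming K (c *\<^sub>R x) = \<bar>c\<bar> * norming K x" and "compact K"
    and nonneg: "\<And>x. norming K x \<ge> 0" and cont: "continuous_on UNIV (norming K)"
    using K by (auto simp: centrally_symmetric_star_body_def)
  obtain R where R: "R > 0" "\<And>x. x \<in> K \<Longrightarrow> norm x \<le> R"
    using compact_imp_bounded[OF \<open>compact K\<close>] by (auto simp: bounded_pos)
  have "norm x \<le> R * norming K x" for x
  proof (rule ccontr)
    assume "\<not> norm x \<le> R * norming K x"
    then have "norming K x < norm x / R" using R(1) by (simp add: field_simps)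
    \<comment> \<open>Dividing by the gauge of x itself is not possible yet, since it might vanish;
      a number t strictly above it is positive.\<close>
    then obtain t where t: "norming K x < t" "t < norm x / R" using dense by blast
    then have "t > 0" using nonneg[of x] by simp
    then have "norming K (inverse t *\<^sub>R x) \<le> 1" using t(1) by (simp add: hom field_simps)
    then have "inverse t *\<^sub>R x \<in> K" using centrally_symmetric_star_body_eq[OF K] by blast
    from R(2)[OF this] show False using t(2) \<open>t > 0\<close> R(1) by (simp add: field_simps)
  qed
  then show thesis
    using hom R(1) cont assms(2) by (intro that[of R]) (unfold_locales, auto)
qed

section \<open>The explicit transform and its uniqueness off the origin\<close>

context homogeneous_gauge
begin

lemma has_fourier_transform_gauge:
  "has_fourier_transform (\<lambda>x. complex_of_real (inverse (N x ^ (DIM('a) - 1))))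
     (\<lambda>\<xi>. complex_of_real (pi * real (DIM('a) - 1) * section_function \<xi>))"
  unfolding has_fourier_transform_def
proof (intro conjI allI impI)
  let ?m = "DIM('a) - 1"
  show "tempered_function (\<lambda>x. complex_of_real (inverse (N x ^ ?m)))"
  proof (rule tempered_functionI[OF dim, where C = "R ^ ?m" and k = 0])
    fix x :: 'a assume "x \<noteq> 0"
    have "inverse (N x ^ ?m) \<le> R ^ ?m * inverse (norm x ^ ?m) * 1"
      using inverse_N_power_le[OF \<open>x \<noteq> 0\<close>] by simp
    also have "\<dots> \<le> R ^ ?m * inverse (norm x ^ ?m) * (1 + norm x ^ 0)"
      using R_pos by (intro mult_left_mono) auto
    finally show "norm (complex_of_real (inverse (N x ^ ?m))) \<le> R ^ ?m * inverse (norm x ^ ?m) * (1 + norm x ^ 0)"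
      using N_nonneg[of x] by (simp only: norm_of_real abs_of_nonneg[OF inverse_nonnegative_iff_nonnegative[THEN iffD2, OF zero_le_power]])
  qed measurable
  show "tempered_function (\<lambda>\<xi>. complex_of_real (pi * real ?m * section_function \<xi>))"
  \<comment> \<open>The bound is of order 1 / |x|, brought into the required shape by
    \<open>inverse_norm_le_weight\<close>, hence k = n - 2.\<close>
  proof (rule tempered_functionI[OF dim, where C = "pi * real ?m * (2 * R) ^ ?m" and k = "DIM('a) - 2"])
    show "(\<lambda>\<xi>. complex_of_real (pi * real ?m * section_function \<xi>)) \<in> borel_measurable borel"
      using borel_section_function by measurable
    fix x :: 'a assume x: "x \<noteq> 0"
    have "section_function x \<le> (2 * R) ^ ?m * (inverse (norm x ^ ?m) * (1 + norm x ^ (DIM('a) - 2)))"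
      using section_function_bounds(2)[OF x] inverse_norm_le_weight[OF x] R_pos
      by (elim order_trans) (intro mult_left_mono, auto)
    then have "pi * real ?m * section_function x \<le> pi * real ?m * ((2 * R) ^ ?m * (inverse (norm x ^ ?m) * (1 + norm x ^ (DIM('a) - 2))))"
      by (intro mult_left_mono) auto
    then show "norm (complex_of_real (pi * real ?m * section_function x))
        \<le> pi * real ?m * (2 * R) ^ ?m * inverse (norm x ^ ?m) * (1 + norm x ^ (DIM('a) - 2))"
      using section_function_bounds(1)[OF x] by (simp only: norm_of_real abs_mult) (simp add: mult.assoc)
  qed
  fix \<phi> :: "'a \<Rightarrow> complex" assume "schwartz \<phi>"
  from integral_gauge_fourier[OF this]
  show "distribution_fourier (distribution_of (\<lambda>x. complex_of_real (inverse (N x ^ ?m)))) \<phi>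
      = distribution_of (\<lambda>\<xi>. complex_of_real (pi * real ?m * section_function \<xi>)) \<phi>"
    unfolding distribution_fourier_def distribution_of_def by (simp only: scaleR_conv_of_real)
qed

lemma section_function_scale:
  assumes "t > 0"
  shows "section_function (t *\<^sub>R x) = inverse t * section_function x"
  using assms by (simp add: section_function_def sgn_scaleR)

end

theorem theorem4:
  fixes K :: "(real ^ 'n) set"
  assumes n: "CARD('n) > 1"
    and K: "centrally_symmetric_star_body K"
  shows "let f = (\<lambda>x::real ^ 'n. complex_of_real (norming K x powi (- int CARD('n) + 1)))
         in (\<exists>g. has_fourier_transform f g \<and> continuous_on (- {0}) g) \<and>
            (\<forall>g. has_fourier_transform f g \<and> continuous_on (- {0}) g \<longrightarrow>
               (\<forall>x t. x \<noteq> 0 \<longrightarrow> t > 0 \<longrightarrow> g (t *\<^sub>R x) = complex_of_real (t powi (- 1)) * g x) \<and>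
               (\<forall>\<xi>\<in>sphere 0 1.
                  complex_of_real (measure (subspace_lborel (perp \<xi>)) (K \<inter> perp \<xi>)) =
                    complex_of_real (1 / (pi * (real CARD('n) - 1))) * g \<xi>))"
proof -
  have DIM: "DIM(real ^ 'n) = CARD('n)" by simp
  obtain R where "homogeneous_gauge (norming K) R"
    using centrally_symmetric_star_body_gauge[OF K] n by auto
  then interpret homogeneous_gauge "norming K" R .
  \<comment> \<open>This also covers x = 0, where both sides are 0 because the exponent is negative
    and \<open>inverse 0 = 0\<close>.\<close>
  have f: "norming K x powi (- int CARD('n) + 1) = inverse (norming K x ^ (CARD('n) - 1))" for x
  proof -
    have "- int CARD('n) + 1 = - int (CARD('n) - 1)" using n by simp
    then show ?thesis by (simp only: power_int_minus power_int_of_nat)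
  qed
  let ?f = "\<lambda>x::real ^ 'n. complex_of_real (norming K x powi (- int CARD('n) + 1))"
  define g0 where "g0 = (\<lambda>\<xi>. complex_of_real (pi * real (CARD('n) - 1) * section_function \<xi>))"
  have g0: "has_fourier_transform ?f g0"
    using has_fourier_transform_gauge unfolding f g0_def DIM .
  have g0_cont: "continuous_on (- {0}) g0"
    unfolding g0_def by (intro continuous_intros continuous_on_section_function)
  \<comment> \<open>The transform is determined only almost everywhere, so continuity is used at
    each p; at the origin g is unconstrained.\<close>
  have unique: "g p = g0 p" if g: "has_fourier_transform ?f g" "continuous_on (- {0}) g" and "p \<noteq> 0" for g p
  proof (rule tempered_function_eqI[where g = g and h = g0 and p = p])
    show "tempered_function g" "tempered_function g0"
      using g g0 by (auto simp: has_fourier_transform_def)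
    show "distribution_of g \<phi> = distribution_of g0 \<phi>" if "schwartz \<phi>" for \<phi>
      using g(1) g0 that by (simp add: has_fourier_transform_def)
    show "isCont g p" "isCont g0 p"
      using g(2) g0_cont \<open>p \<noteq> 0\<close> by (auto simp: continuous_on_eq_continuous_at open_Compl)
  qed
  have "g (t *\<^sub>R x) = complex_of_real (t powi (- 1)) * g x"
    if "has_fourier_transform ?f g" "continuous_on (- {0}) g" "x \<noteq> 0" "t > 0" for g x t
    using unique[OF that(1,2)] that(3,4)
    by (simp add: g0_def section_function_scale power_int_minus)
  moreover have "complex_of_real (measure (subspace_lborel (perp \<xi>)) (K \<inter> perp \<xi>)) =
      complex_of_real (1 / (pi * (real CARD('n) - 1))) * g \<xi>"
    if "has_fourier_transform ?f g" "continuous_on (- {0}) g" "norm \<xi> = 1" for g \<xi>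
  proof -
    \<comment> \<open>On the unit sphere the homogeneous extension reduces to the section volume
      itself.\<close>
    have "\<xi> \<noteq> 0" "sgn \<xi> = \<xi>" using that(3) by (auto simp: sgn_div_norm)
    then have "section_function \<xi> = measure (subspace_lborel (perp \<xi>)) (K \<inter> perp \<xi>)"
      using centrally_symmetric_star_body_eq[OF K] that(3) by (simp add: section_function_def)
    moreover have "1 / (pi * (real CARD('n) - 1)) * (pi * real (CARD('n) - 1) * s) = s" for s
      using n by (simp add: of_nat_diff)
    ultimately show ?thesis
      unfolding unique[OF that(1,2) \<open>\<xi> \<noteq> 0\<close>] g0_def by (simp only: of_real_mult[symmetric])
  qed
  ultimately show ?thesis
    using g0 g0_cont unfolding Let_def Ball_def mem_sphere_0 by blast
qed

end
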